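(* For every partition $\lambda$, we have an isomorphism of $\mathfrak{gl}_{\mathcal N}$-crystals $$\mathbf B(\lambda)\simeq\bigoplus_{T\in ST(\lambda)}\mathbf B(\alpha(T)),$$ where $\mathbf B(\lambda)=\mathbf B_{\mathcal N}(\lambda)$ is the crystal of semistandard tableaux of shape $\lambda$ with entries in $\mathcal N$ and $ST(\lambda)$ is the set of standard tableaux of shape $\lambda$.
   Context: $\mathcal N=\frac12\mathbb Z_{>0}$ with its usual linear order; elements of $\mathbb Z_{>0}$ are even, elements of $\frac12+\mathbb Z_{\ge0}$ are odd. $I=\frac12\mathbb Z_{>0}$. Weights: $\bigoplus_{b\in\mathcal N}\mathbb Z\epsilon_b$ with $(\epsilon_a,\epsilon_b)=(-1)^{|a|}\delta_{ab}$ ($|a|$ the parity), simple roots $\alpha_i=\epsilon_i-\epsilon_{i+\frac12}$, $i\in I$. A $\mathfrak{gl}_{\mathcal N}$-crystal is a set $B$ with maps $\mathrm{wt}:B\to\bigoplus\mathbb Z\epsilon_b$, $\varepsilon_i,\varphi_i:B\to\mathbb Z_{\ge0}$, $e_i,f_i:B\to B\cup\{\mathbf 0\}$ ($\mathbf 0$ a formal symbol) such that: (1) $\varphi_i(b)+\varepsilon_i(b)$ is $1$ if $(\mathrm{wt}(b),\alpha_i)\ne0$ and $0$ otherwise; (2) if $e_ib\in B$ then $\varepsilon_i(e_ib)=\varepsilon_i(b)-1$, $\varphi_i(e_ib)=\varphi_i(b)+1$, $\mathrm{wt}(e_ib)=\mathrm{wt}(b)+\alpha_i$; (3) if $f_ib\in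 B$ then $\varepsilon_i(f_ib)=\varepsilon_i(b)+1$, $\varphi_i(f_ib)=\varphi_i(b)-1$, $\mathrm{wt}(f_ib)=\mathrm{wt}(b)-\alpha_i$; (4) $f_ib=b'$ iff $b=e_ib'$. It is viewed as an $I$-colored oriented graph ($b\xrightarrow{i}b'$ iff $b'=f_ib$). An isomorphism $\simeq$ of crystals is an isomorphism of colored oriented graphs preserving $\mathrm{wt},\varepsilon_i,\varphi_i$; $\bigoplus$ is disjoint union. Crystal of words: $\mathbf W$ is the set of finite words in $\mathcal N$ (including the empty word), $\mathrm{wt}(w_1\cdots w_r)=\sum_k\epsilon_{w_k}$. On letters, $f_i(i)=i+\frac12$, $e_i(i+\frac12)=i$, all other $e_i,f_i$ give $\mathbf 0$. On a word: for $i\in\mathbb Z_{>0}$ (resp. $i\in\frac12+\mathbb Z_{\ge0}$) let $k$ be the smallest (resp. largest) index with $w_k\in\{i,i+\frac12\}$; $e_i$, $f_i$ act by applying $e_i$, $f_i$ to $w_k$ ($\mathbf 0$ if that gives $\mathbf 0$); if no such $k$ exists, the result is $\mathbf 0$. $\varepsilon_i$ (resp. $\varphi_i$) is $1$ if $e_i$ (resp. $f_i$) does not give $\mathbf 0$, else $0$. A semistandard tableau of shape $\lambda$ (Young diagram, English convention) with entries in $\mathcal N$ is a filling weakly increasing along rows (left to right) and columns (top to bottom), with integers strictly increasing in columns and odd half-integers strictly increasing in rows. $\mathbf B(\lambda)$ is a crystal by identifying a tableau $T$ with the word obtained by an admissible reading, i.e. a reading in which $T(i,j)$ is read before $T(i+1,j)$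 and $T(i,j-1)$ (e.g. rows top to bottom, each row right to left); the image is stable under $e_i,f_i$ and the structure does not depend on the choice of reading. A standard tableau $T$ of shape $\lambda$, with $r$ nodes, is a bijection from the nodes to $\{1,\dots,r\}$ increasing along rows and columns. Its descent set is $D(T)=\{\,k\mid$ the column index of $T^{-1}(k)$ is $\ge$ that of $T^{-1}(k+1)\,\}\subset\{1,\dots,r-1\}$. For $S=\{i_1<\cdots<i_s\}\subset\{1,\dots,r-1\}$, $\alpha(S)=(i_1,i_2-i_1,\dots,r-i_s)$ (empty composition if $r=0$), and $\alpha(T)=\alpha(D(T))$. A composition $\alpha=(\alpha_1,\dots,\alpha_t)$ is identified with its ribbon diagram: rows from top to bottom have $\alpha_1,\dots,\alpha_t$ nodes, and the leftmost node of row $i+1$ is directly below the rightmost node of row $i$. $\mathbf B(\alpha)$ is the set of quasi-ribbon tableaux of shape $\alpha$: fillings with entries in $\mathcal N$ weakly increasing along rows and columns, with integers strictly increasing in each column and odd half-integers strictly increasing in each row; it is a crystal by identifying a tableau with its word obtained by reading rows top to bottom, each row right to left. *)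

theory Defs
  imports Complex_Main "HOL-Library.FuncSet" "HOL-Library.Poly_Mapping"
begin

section \<open>Letters and weights\<close>

text \<open>The type \<open>halfint\<close> is both the alphabet and the index set of the simple roots.\<close>

typedef halfint = "{q :: rat. \<exists>n :: nat. 0 < n \<and> q = of_nat n / 2}"
  morphisms rat_of_half half_of_rat
  by (intro exI[of _ "1 / 2"] CollectI exI[of _ "1 :: nat"]) simp

instantiation halfint :: linorder
begin
definition less_eq_halfint :: "halfint \<Rightarrow> halfint \<Rightarrow> bool" where
  "a \<le> b \<longleftrightarrow> rat_of_half a \<le> rat_of_half b"
definition less_halfint :: "halfint \<Rightarrow> halfint \<Rightarrow> bool" where
  "a < b \<longleftrightarrow> rat_of_half a < rat_of_half b"
instance
  by standard (auto simp: less_eq_halfint_def less_halfint_def rat_of_half_inject)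
end

definition integral :: "halfint \<Rightarrow> bool" where
  "integral b \<longleftrightarrow> rat_of_half b \<in> \<int>"

definition plus_half :: "halfint \<Rightarrow> halfint" where
  "plus_half i = half_of_rat (rat_of_half i + 1 / 2)"

lemma rat_of_plus_half: "rat_of_half (plus_half i) = rat_of_half i + 1 / 2"
proof -
  obtain n :: nat where n: "0 < n" "rat_of_half i = of_nat n / 2"
    using rat_of_half[of i] by auto
  then have "rat_of_half i + 1 / 2 = of_nat (Suc n) / 2" by simp
  then have "rat_of_half i + 1 / 2 \<in> {q. \<exists>n :: nat. 0 < n \<and> q = of_nat n / 2}" by blast
  then show ?thesis by (simp add: plus_half_def half_of_rat_inverse)
qed

type_synonym weight = "halfint \<Rightarrow>\<^sub>0 int"

definition eps_vec :: "halfint \<Rightarrow> weight" where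
  "eps_vec b = Poly_Mapping.single b 1"

definition pairing :: "weight \<Rightarrow> weight \<Rightarrow> int" where
  "pairing \<mu> \<nu> = (\<Sum>b\<in>Poly_Mapping.keys \<mu>. (if integral b then 1 else - 1)
      * Poly_Mapping.lookup \<mu> b * Poly_Mapping.lookup \<nu> b)"

definition simple_root :: "halfint \<Rightarrow> weight" where
  "simple_root i = eps_vec i - eps_vec (plus_half i)"

section \<open>Crystals\<close>

text \<open>\<open>None\<close> plays the role of the formal symbol \<open>\<zero>\<close>.  The maps are only meaningful on the
  carrier.\<close>

record 'b crystal =
  elems :: "'b set"
  wt :: "'b \<Rightarrow> weight"
  eps :: "halfint \<Rightarrow> 'b \<Rightarrow> nat"
  phi :: "halfint \<Rightarrow> 'b \<Rightarrow> nat"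
  e_op :: "halfint \<Rightarrow> 'b \<Rightarrow> 'b option"
  f_op :: "halfint \<Rightarrow> 'b \<Rightarrow> 'b option"

definition is_crystal :: "'b crystal \<Rightarrow> bool" where
  "is_crystal B \<longleftrightarrow>
    (\<forall>i. \<forall>b\<in>elems B.
      (\<forall>b'. e_op B i b = Some b' \<longrightarrow> b' \<in> elems B) \<and>
      (\<forall>b'. f_op B i b = Some b' \<longrightarrow> b' \<in> elems B) \<and>
      phi B i b + eps B i b = (if pairing (wt B b) (simple_root i) \<noteq> 0 then 1 else 0) \<and>
      (\<forall>b'. e_op B i b = Some b' \<longrightarrow>
        int (eps B i b') = int (eps B i b) - 1 \<and>
        int (phi B i b') = int (phi B i b) + 1 \<and>
        wt B b' = wt B b + simple_root i) \<and>
      (\<forall>b'. f_op B i b = Some b' \<longrightarrow>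
        int (eps B i b') = int (eps B i b) + 1 \<and>
        int (phi B i b') = int (phi B i b) - 1 \<and>
        wt B b' = wt B b - simple_root i) \<and>
      (\<forall>b'\<in>elems B. f_op B i b = Some b' \<longleftrightarrow> e_op B i b' = Some b))"

definition crystal_isomorphism :: "'b crystal \<Rightarrow> 'c crystal \<Rightarrow> ('b \<Rightarrow> 'c) \<Rightarrow> bool" where
  "crystal_isomorphism B C h \<longleftrightarrow>
    is_crystal B \<and> is_crystal C \<and> bij_betw h (elems B) (elems C) \<and>
    (\<forall>i. \<forall>b\<in>elems B. \<forall>b'\<in>elems B.
      f_op B i b = Some b' \<longleftrightarrow> f_op C i (h b) = Some (h b')) \<and>
    (\<forall>b\<in>elems B. wt C (h b) = wt B b \<and>
      (\<forall>i. eps C i (h b) = eps B i b \<and> phi C i (h b) = phi B i b))"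

definition crystal_isomorphic :: "'b crystal \<Rightarrow> 'c crystal \<Rightarrow> bool"  (infix "\<simeq>\<^sub>c" 50) where
  "B \<simeq>\<^sub>c C \<longleftrightarrow> (\<exists>h. crystal_isomorphism B C h)"

definition crystal_sum :: "'x set \<Rightarrow> ('x \<Rightarrow> 'b crystal) \<Rightarrow> ('x \<times> 'b) crystal" where
  "crystal_sum X B = \<lparr>
    elems = Sigma X (\<lambda>x. elems (B x)),
    wt = (\<lambda>(x, b). wt (B x) b),
    eps = (\<lambda>i (x, b). eps (B x) i b),
    phi = (\<lambda>i (x, b). phi (B x) i b),
    e_op = (\<lambda>i (x, b). map_option (Pair x) (e_op (B x) i b)),
    f_op = (\<lambda>i (x, b). map_option (Pair x) (f_op (B x) i b))\<rparr>"

text \<open>The structure on a set \<open>A\<close> obtained by identifying it, via a map \<open>\<rho>\<close> injective on \<open>A\<close>,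
  with the subset \<open>\<rho> ` A\<close> of a crystal.  If that subset is not stable under the operators, the
  result need not be a crystal.\<close>

definition pullback_crystal :: "'a set \<Rightarrow> ('a \<Rightarrow> 'b) \<Rightarrow> 'b crystal \<Rightarrow> 'a crystal" where
  "pullback_crystal A \<rho> B = \<lparr>
    elems = A,
    wt = (\<lambda>a. wt B (\<rho> a)),
    eps = (\<lambda>i a. eps B i (\<rho> a)),
    phi = (\<lambda>i a. phi B i (\<rho> a)),
    e_op = (\<lambda>i a. map_option (inv_into A \<rho>) (e_op B i (\<rho> a))),
    f_op = (\<lambda>i a. map_option (inv_into A \<rho>) (f_op B i (\<rho> a)))\<rparr>"

section \<open>The crystal of words\<close>

definition letter_e :: "halfint \<Rightarrow> halfint \<Rightarrow> halfint option" where
  "letter_e i a = (if a = plus_half i then Some i else None)"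

definition letter_f :: "halfint \<Rightarrow> halfint \<Rightarrow> halfint option" where
  "letter_f i a = (if a = i then Some (plus_half i) else None)"

definition active_indices :: "halfint \<Rightarrow> halfint list \<Rightarrow> nat set" where
  "active_indices i w = {k. k < length w \<and> w ! k \<in> {i, plus_half i}}"

definition act_on_word ::
  "(halfint \<Rightarrow> halfint \<Rightarrow> halfint option) \<Rightarrow> halfint \<Rightarrow> halfint list \<Rightarrow> halfint list option" where
  "act_on_word g i w =
    (if active_indices i w = {} then None
     else let k = (if integral i then Min (active_indices i w) else Max (active_indices i w))
       in map_option (\<lambda>a. w[k := a]) (g i (w ! k)))"

definition word_crystal :: "halfint list crystal" where
  "word_crystal = \<lparr>
    elems = UNIV,
    wt = (\<lambda>w. \<Sum>b\<leftarrow>w. eps_vec b),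
    eps = (\<lambda>i w. if act_on_word letter_e i w \<noteq> None then 1 else 0),
    phi = (\<lambda>i w. if act_on_word letter_f i w \<noteq> None then 1 else 0),
    e_op = act_on_word letter_e,
    f_op = act_on_word letter_f\<rparr>"

section \<open>Tableaux\<close>

text \<open>A node is a pair (row, column), both counted from 0, with rows going down and columns going
  right.  Fillings of a diagram \<open>D\<close> are functions that are \<open>undefined\<close> outside \<open>D\<close>.  The same
  conditions on fillings define semistandard tableaux (on Young diagrams) and quasi-ribbon tableaux
  (on ribbons).\<close>

type_synonym node = "nat \<times> nat"

definition tableaux :: "node set \<Rightarrow> (node \<Rightarrow> halfint) set" where
  "tableaux D = {T \<in> D \<rightarrow>\<^sub>E UNIV.
    (\<forall>i j j'. (i, j) \<in> D \<and> (i, j') \<in> D \<and> j < j' \<longrightarrow>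
      T (i, j) \<le> T (i, j') \<and> (\<not> integral (T (i, j)) \<longrightarrow> T (i, j) < T (i, j'))) \<and>
    (\<forall>i i' j. (i, j) \<in> D \<and> (i', j) \<in> D \<and> i < i' \<longrightarrow>
      T (i, j) \<le> T (i', j) \<and> (integral (T (i, j)) \<longrightarrow> T (i, j) < T (i', j)))}"

text \<open>A reading of a diagram is an enumeration of its nodes.\<close>

definition tableau_crystal :: "node set \<Rightarrow> node list \<Rightarrow> (node \<Rightarrow> halfint) crystal" where
  "tableau_crystal D reading = pullback_crystal (tableaux D) (\<lambda>T. map T reading) word_crystal"

definition is_partition :: "nat list \<Rightarrow> bool" where
  "is_partition lam \<longleftrightarrow> sorted_wrt (\<ge>) lam \<and> (\<forall>p\<in>set lam. 0 < p)"

definition young_diagram :: "nat list \<Rightarrow> node set" where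
  "young_diagram lam = {(i, j). i < length lam \<and> j < lam ! i}"

definition admissible_reading :: "node set \<Rightarrow> node list \<Rightarrow> bool" where
  "admissible_reading D reading \<longleftrightarrow> distinct reading \<and> set reading = D \<and>
    (\<forall>k l i j. k < length reading \<and> l < length reading \<and> reading ! k = (i, j) \<and>
      (reading ! l = (i + 1, j) \<or> 0 < j \<and> reading ! l = (i, j - 1)) \<longrightarrow> k < l)"

definition ribbon_start :: "nat list \<Rightarrow> nat \<Rightarrow> nat" where
  "ribbon_start \<alpha> i = (\<Sum>l<i. \<alpha> ! l - 1)"

definition ribbon_diagram :: "nat list \<Rightarrow> node set" where
  "ribbon_diagram \<alpha> =
    {(i, j). i < length \<alpha> \<and> ribbon_start \<alpha> i \<le> j \<and> j < ribbon_start \<alpha> i + \<alpha> ! i}"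

definition ribbon_reading :: "nat list \<Rightarrow> node list" where
  "ribbon_reading \<alpha> = concat (map (\<lambda>i. map (Pair i)
      (rev [ribbon_start \<alpha> i ..< ribbon_start \<alpha> i + \<alpha> ! i])) [0 ..< length \<alpha>])"

definition young_crystal :: "nat list \<Rightarrow> node list \<Rightarrow> (node \<Rightarrow> halfint) crystal" where
  "young_crystal lam reading = tableau_crystal (young_diagram lam) reading"

definition ribbon_crystal :: "nat list \<Rightarrow> (node \<Rightarrow> halfint) crystal" where
  "ribbon_crystal \<alpha> = tableau_crystal (ribbon_diagram \<alpha>) (ribbon_reading \<alpha>)"

text \<open>Admissible readings of Young diagrams exist: rows from top to bottom, each from right to
  left.\<close>

definition row_reading :: "nat list \<Rightarrow> node list" where
  "row_reading lam = concat (map (\<lambda>i. map (Pair i) (rev [0 ..< lam ! i])) [0 ..< length lam])"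

lemma admissible_row_reading: "admissible_reading (young_diagram lam) (row_reading lam)"
proof -
  let ?R = "\<lambda>a b :: node. fst a < fst b \<or> fst a = fst b \<and> snd b < snd a"
  let ?row = "\<lambda>i. map (Pair i) (rev [0 ..< lam ! i])"
  have row: "sorted_wrt ?R (?row i)" for i
    by (simp add: sorted_wrt_map sorted_wrt_rev)
  have "sorted_wrt ?R (concat (map ?row [0 ..< n]))" for n
    by (induction n) (use row in \<open>auto simp: sorted_wrt_append\<close>)
  then have s: "sorted_wrt ?R (row_reading lam)" by (simp add: row_reading_def)
  have d: "distinct (row_reading lam)"
    using s by (auto simp: distinct_conv_nth sorted_wrt_iff_nth_less)
      (metis less_irrefl linorder_neqE_nat)
  have S: "set (row_reading lam) = young_diagram lam"
    by (auto simp: row_reading_def young_diagram_def)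
  have "k < l" if "k < length (row_reading lam)" "l < length (row_reading lam)"
    "?R (row_reading lam ! k) (row_reading lam ! l)" for k l
  proof (rule ccontr)
    assume "\<not> k < l"
    then have "k = l \<or> ?R (row_reading lam ! l) (row_reading lam ! k)"
      using s that(1) sorted_wrt_nth_less[OF s, of l k] by linarith
    then show False using that(3) by auto
  qed
  then show ?thesis using d S by (auto simp: admissible_reading_def)
qed

section \<open>Standard tableaux and descent compositions\<close>

definition standard_tableaux :: "nat list \<Rightarrow> (node \<Rightarrow> nat) set" where
  "standard_tableaux lam = {T \<in> young_diagram lam \<rightarrow>\<^sub>E UNIV.
    bij_betw T (young_diagram lam) {1..sum_list lam} \<and>
    (\<forall>i j j'. (i, j) \<in> young_diagram lam \<and> (i, j') \<in> young_diagram lam \<and> j < j' \<longrightarrow>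
      T (i, j) < T (i, j')) \<and>
    (\<forall>i i' j. (i, j) \<in> young_diagram lam \<and> (i', j) \<in> young_diagram lam \<and> i < i' \<longrightarrow>
      T (i, j) < T (i', j))}"

definition node_of :: "nat list \<Rightarrow> (node \<Rightarrow> nat) \<Rightarrow> nat \<Rightarrow> node" where
  "node_of lam T k = inv_into (young_diagram lam) T k"

definition descent_set :: "nat list \<Rightarrow> (node \<Rightarrow> nat) \<Rightarrow> nat set" where
  "descent_set lam T = {k \<in> {1 ..< sum_list lam}.
    snd (node_of lam T k) \<ge> snd (node_of lam T (k + 1))}"

definition composition_of_set :: "nat \<Rightarrow> nat set \<Rightarrow> nat list" where
  "composition_of_set r S = (if r = 0 then []
    else let xs = sorted_list_of_set S in map2 (\<lambda>a b. b - a) (0 # xs) (xs @ [r]))"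

definition descent_composition :: "nat list \<Rightarrow> (node \<Rightarrow> nat) \<Rightarrow> nat list" where
  "descent_composition lam T = composition_of_set (sum_list lam) (descent_set lam T)"

end

theory Submission
  imports Defs
begin

text \<open>
  A semistandard tableau \<open>T\<close> is determined by its standardization \<open>S\<close> and the weakly increasing
  word \<open>a\<close> of its entries in the order of \<open>S\<close>.  For fixed \<open>S\<close>, the words that occur are those in
  which equality of the letters \<open>k\<close> and \<open>k + 1\<close> forces \<open>k\<close> to be a descent of \<open>S\<close> if the common
  letter is odd, and a non-descent if it is an integer.  These are also exactly the words of entries
  of the quasi-ribbon tableaux of shape \<open>\<alpha>(S)\<close>.  In an admissible reading of either shape, node
  \<open>k\<close> precedes node \<open>k + 1\<close> if and only if \<open>k\<close> is a descent.  This determines the letter of \<open>a\<close> on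
  which \<open>e\<^sub>i\<close> and \<open>f\<^sub>i\<close> act in terms of \<open>a\<close> and the descent set alone, and the result is again
  such a word for \<open>S\<close>.
\<close>

section \<open>Half-integers\<close>

text \<open>Let the letters \<open>i\<close> and \<open>plus_half i\<close> occupy a block of the
  increasing word. They have opposite parity, so compatibility makes all steps inside one of the two
  runs descents and all steps inside the other non-descents; only the step between the runs is free.
  The places of these letters in a reading are therefore monotone on each run, in opposite
  directions, with the extremum at the junction. It is a minimum for integral \<open>i\<close> and a
  maximum for odd \<open>i\<close>, which is precisely the side from which the operators choose
  their letter. The free step decides whether this letter is the last \<open>i\<close> or the first
  \<open>plus_half i\<close>, and its value is just the one required after the letter has joined the
  other run. No inspection of shapes remains in the action, so stability of the tableaux and the
  isomorphism, for any admissible reading, come from one computation.\<close>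

lemma halfint_cases:
  obtains n :: nat where "0 < n" "rat_of_half i = of_nat n / 2"
  using rat_of_half[of i] by auto

lemma less_plus_half [simp]: "i < plus_half i"
  by (simp add: less_halfint_def rat_of_plus_half)

text \<open>The alphabet is discrete: after doubling, this compares \<open>Suc m <= n\<close> with
  \<open>m < n\<close> for natural numbers.\<close>

lemma plus_half_le_iff: "plus_half i \<le> a \<longleftrightarrow> i < a"
proof -
  obtain m n :: nat where "rat_of_half i = of_nat m / 2" "rat_of_half a = of_nat n / 2"
    using halfint_cases by metis
  then show ?thesis
    by (simp add: less_halfint_def less_eq_halfint_def rat_of_plus_half field_simps
        flip: of_nat_Suc) linarith
qed

lemma plus_half_le [simp]: "\<not> plus_half i \<le> i" "i \<le> plus_half i"
  using less_plus_half[of i] by (simp_all only: not_le less_imp_le)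

lemma plus_half_neq [simp]: "plus_half i \<noteq> i" "i \<noteq> plus_half i"
  using less_plus_half[of i] by force+

lemma integral_plus_half [simp]: "integral (plus_half i) \<longleftrightarrow> \<not> integral i"
proof -
  have half: "of_nat n / 2 \<in> (\<int> :: rat set) \<longleftrightarrow> even n" for n :: nat
  proof
    assume "of_nat n / 2 \<in> (\<int> :: rat set)"
    then obtain z where "of_nat n / 2 = (of_int z :: rat)" by (auto elim: Ints_cases)
    then have "(of_int (int n) :: rat) = of_int (2 * z)" by simp
    then have "int n = 2 * z" by (simp only: of_int_eq_iff)
    then show "even n" by presburger
  next
    assume "even n"
    then show "of_nat n / 2 \<in> (\<int> :: rat set)" by (auto elim!: evenE)
  qed
  obtain n :: nat where n: "rat_of_half i = of_nat n / 2" by (rule halfint_cases)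
  then have "rat_of_half (plus_half i) = of_nat (Suc n) / 2"
    by (simp add: rat_of_plus_half)
  then show ?thesis unfolding integral_def n by (simp only: half even_Suc)
qed

section \<open>Constructions of crystals\<close>

lemma is_crystalI:
  assumes "\<And>i b. b \<in> elems B \<Longrightarrow>
      phi B i b + eps B i b = (if pairing (wt B b) (simple_root i) \<noteq> 0 then 1 else 0)"
    and "\<And>i b b'. b \<in> elems B \<Longrightarrow> e_op B i b = Some b' \<Longrightarrow>
      b' \<in> elems B \<and> int (eps B i b') = int (eps B i b) - 1 \<and>
      int (phi B i b') = int (phi B i b) + 1 \<and> wt B b' = wt B b + simple_root i"
    and "\<And>i b b'. b \<in> elems B \<Longrightarrow> f_op B i b = Some b' \<Longrightarrow>
      b' \<in> elems B \<and> int (eps B i b') = int (eps B i b) + 1 \<and>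
      int (phi B i b') = int (phi B i b) - 1 \<and> wt B b' = wt B b - simple_root i"
    and "\<And>i b b'. b \<in> elems B \<Longrightarrow> b' \<in> elems B \<Longrightarrow>
      f_op B i b = Some b' \<longleftrightarrow> e_op B i b' = Some b"
  shows "is_crystal B"
  unfolding is_crystal_def
proof (intro allI ballI conjI impI, goal_cases)
  case 1 then show ?case using assms(2) by blast
next
  case 2 then show ?case using assms(3) by blast
next
  case 3 then show ?case using assms(1) by blast
next
  case 4 then show ?case using assms(2) by blast
next
  case 5 then show ?case using assms(2) by blast
next
  case 6 then show ?case using assms(2) by blast
next
  case 7 then show ?case using assms(3) by blast
next
  case 8 then show ?case using assms(3) by blast
next
  case 9 then show ?case using assms(3) by blast
next
  case 10 then show ?case using assms(4) by blast
qed

lemma is_crystalD: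
  assumes "is_crystal B" "b \<in> elems B"
  shows "phi B i b + eps B i b = (if pairing (wt B b) (simple_root i) \<noteq> 0 then 1 else 0)"
    and "e_op B i b = Some b' \<Longrightarrow>
      b' \<in> elems B \<and> int (eps B i b') = int (eps B i b) - 1 \<and>
      int (phi B i b') = int (phi B i b) + 1 \<and> wt B b' = wt B b + simple_root i"
    and "f_op B i b = Some b' \<Longrightarrow>
      b' \<in> elems B \<and> int (eps B i b') = int (eps B i b) + 1 \<and>
      int (phi B i b') = int (phi B i b) - 1 \<and> wt B b' = wt B b - simple_root i"
    and "b' \<in> elems B \<Longrightarrow> f_op B i b = Some b' \<longleftrightarrow> e_op B i b' = Some b"
proof -
  note ax = assms(1)[unfolded is_crystal_def, THEN spec[of _ i], THEN bspec, OF assms(2)]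
  show "phi B i b + eps B i b = (if pairing (wt B b) (simple_root i) \<noteq> 0 then 1 else 0)"
    using ax by blast
  show "b' \<in> elems B \<and> int (eps B i b') = int (eps B i b) - 1 \<and>
      int (phi B i b') = int (phi B i b) + 1 \<and> wt B b' = wt B b + simple_root i"
    if "e_op B i b = Some b'" using ax that by blast
  show "b' \<in> elems B \<and> int (eps B i b') = int (eps B i b) + 1 \<and>
      int (phi B i b') = int (phi B i b) - 1 \<and> wt B b' = wt B b - simple_root i"
    if "f_op B i b = Some b'" using ax that by blast
  show "f_op B i b = Some b' \<longleftrightarrow> e_op B i b' = Some b" if "b' \<in> elems B"
    using ax that by blast
qed

text \<open>Stability puts the results of the operators into the range of \<open>\<rho>\<close>,
  where \<open>inv_into\<close> is a genuine inverse; outside the range it would return an arbitrary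
  element.\<close>

lemma is_crystal_pullback:
  assumes B: "is_crystal B" and inj: "inj_on \<rho> A" and sub: "\<rho> ` A \<subseteq> elems B"
    and stable_e: "\<And>i a b. a \<in> A \<Longrightarrow> e_op B i (\<rho> a) = Some b \<Longrightarrow> b \<in> \<rho> ` A"
    and stable_f: "\<And>i a b. a \<in> A \<Longrightarrow> f_op B i (\<rho> a) = Some b \<Longrightarrow> b \<in> \<rho> ` A"
  shows "is_crystal (pullback_crystal A \<rho> B)"
proof -
  let ?P = "pullback_crystal A \<rho> B"
  have elems: "elems ?P = A" and wt: "wt ?P a = wt B (\<rho> a)"
    and eps: "eps ?P i a = eps B i (\<rho> a)" and phi: "phi ?P i a = phi B i (\<rho> a)" for i a
    by (simp_all add: pullback_crystal_def)
  have e: "e_op ?P i a = Some a' \<longleftrightarrow> a' \<in> A \<and> e_op B i (\<rho> a) = Some (\<rho> a')"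
    if "a \<in> A" for i a a'
    using stable_e[OF that, of i] inj
    by (cases "e_op B i (\<rho> a)") (auto simp: inv_into_f_f pullback_crystal_def)
  have f: "f_op ?P i a = Some a' \<longleftrightarrow> a' \<in> A \<and> f_op B i (\<rho> a) = Some (\<rho> a')"
    if "a \<in> A" for i a a'
    using stable_f[OF that, of i] inj
    by (cases "f_op B i (\<rho> a)") (auto simp: inv_into_f_f pullback_crystal_def)
  note D = is_crystalD[OF B subsetD[OF sub imageI]]
  show ?thesis
  proof (rule is_crystalI, unfold elems, goal_cases)
    case (1 i a) then show ?case using D(1) by (simp add: wt eps phi)
  next
    case (2 i a a')
    then show ?case using D(2)[of a i "\<rho> a'"] by (simp add: wt eps phi e)
  next
    case (3 i a a')
    then show ?case using D(3)[of a i "\<rho> a'"] by (simp add: wt eps phi f)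
  next
    case (4 i a a')
    then show ?case using D(4)[of a "\<rho> a'" i] sub by (auto simp: e f)
  qed
qed

lemma is_crystal_sum:
  assumes "\<And>x. x \<in> X \<Longrightarrow> is_crystal (B x)"
  shows "is_crystal (crystal_sum X B)"
proof (rule is_crystalI, goal_cases)
  case (1 i b)
  then obtain x y where b: "b = (x, y)" "x \<in> X" "y \<in> elems (B x)"
    by (auto simp: crystal_sum_def)
  then show ?case using is_crystalD(1)[OF assms[OF b(2)] b(3), of i]
    by (simp add: crystal_sum_def)
next
  case (2 i b b')
  then show ?case using is_crystalD(2)[OF assms] by (auto simp: crystal_sum_def)
next
  case (3 i b b')
  then show ?case using is_crystalD(3)[OF assms] by (auto simp: crystal_sum_def)
next
  case (4 i b b')
  then show ?case using is_crystalD(4)[OF assms] by (auto simp: crystal_sum_def)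
qed

text \<open>An equation between options is the form in which the two sides get computed below. The
  equivalence in the definition follows because \<open>f_op\<close> stays in the carrier, where
  \<open>h\<close> is injective.\<close>

lemma crystal_isomorphismI:
  assumes "is_crystal B" "is_crystal C" and bij: "bij_betw h (elems B) (elems C)"
    and f: "\<And>i b. b \<in> elems B \<Longrightarrow> f_op C i (h b) = map_option h (f_op B i b)"
    and "\<And>b. b \<in> elems B \<Longrightarrow> wt C (h b) = wt B b"
    and "\<And>i b. b \<in> elems B \<Longrightarrow> eps C i (h b) = eps B i b"
    and "\<And>i b. b \<in> elems B \<Longrightarrow> phi C i (h b) = phi B i b"
  shows "crystal_isomorphism B C h"
proof -
  have "f_op B i b = Some b' \<longleftrightarrow> f_op C i (h b) = Some (h b')"
    if "b \<in> elems B" "b' \<in> elems B" for i b b'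
  proof -
    have "c \<in> elems B" if "f_op B i b = Some c" for c
      using is_crystalD(3)[OF assms(1)] that \<open>b \<in> elems B\<close> by blast
    then show ?thesis
      using f[OF that(1), of i] that(2) bij by (auto simp: bij_betw_def inj_on_eq_iff)
  qed
  then show ?thesis using assms by (simp add: crystal_isomorphism_def)
qed

section \<open>The crystal of words\<close>

definition active_index :: "halfint \<Rightarrow> halfint list \<Rightarrow> nat" where
  "active_index i w = (if integral i then Min (active_indices i w) else Max (active_indices i w))"

lemma finite_active_indices [simp]: "finite (active_indices i w)"
  by (simp add: active_indices_def)

lemma active_index_in: "active_indices i w \<noteq> {} \<Longrightarrow> active_index i w \<in> active_indices i w"
  by (simp add: active_index_def)

lemma act_on_word_Some_iff:
  "act_on_word g i w = Some w' \<longleftrightarrow> active_indices i w \<noteq> {} \<and>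
    (\<exists>b. g i (w ! active_index i w) = Some b \<and> w' = w[active_index i w := b])"
  by (auto simp: act_on_word_def active_index_def Let_def)

lemma act_on_word_None_iff:
  "act_on_word g i w = None \<longleftrightarrow> active_indices i w = {} \<or> g i (w ! active_index i w) = None"
  by (auto simp: act_on_word_def active_index_def Let_def)

lemma active_indices_update:
  "k \<in> active_indices i w \<Longrightarrow> b \<in> {i, plus_half i} \<Longrightarrow>
    active_indices i (w[k := b]) = active_indices i w"
  by (auto simp: active_indices_def nth_list_update)

lemma active_index_update:
  assumes "active_indices i w \<noteq> {}" "b \<in> {i, plus_half i}"
  shows "active_index i (w[active_index i w := b]) = active_index i w"
  using active_indices_update[OF active_index_in[OF assms(1)] assms(2)]
  unfolding active_index_def by (cases "integral i") simp_all

lemma act_on_word_f_iff: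
  "act_on_word letter_f i w = Some w' \<longleftrightarrow> active_indices i w \<noteq> {} \<and>
    w ! active_index i w = i \<and> w' = w[active_index i w := plus_half i]"
  by (auto simp: act_on_word_Some_iff letter_f_def)

lemma act_on_word_e_iff:
  "act_on_word letter_e i w = Some w' \<longleftrightarrow> active_indices i w \<noteq> {} \<and>
    w ! active_index i w = plus_half i \<and> w' = w[active_index i w := i]"
  by (auto simp: act_on_word_Some_iff letter_e_def)

text \<open>Exchanging \<open>i\<close> and \<open>plus_half i\<close> at the active index leaves
  the set of active indices alone, so the inverse operator finds the same position again.\<close>

lemma act_on_word_f_iff_e:
  "act_on_word letter_f i w = Some w' \<longleftrightarrow> act_on_word letter_e i w' = Some w"
proof
  assume "act_on_word letter_f i w = Some w'"
  then have w: "active_indices i w \<noteq> {}" "w ! active_index i w = i"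
    "w' = w[active_index i w := plus_half i]" by (auto simp: act_on_word_f_iff)
  then have "active_indices i w' = active_indices i w"
    using active_index_in[OF w(1)] by (simp add: active_indices_update)
  then show "act_on_word letter_e i w' = Some w"
    using w(1,2) active_index_in[OF w(1)] list_update_id[of w "active_index i w"]
    by (simp add: act_on_word_e_iff w(3) active_index_update)
      (simp add: active_indices_def)
next
  assume "act_on_word letter_e i w' = Some w"
  then have w: "active_indices i w' \<noteq> {}" "w' ! active_index i w' = plus_half i"
    "w = w'[active_index i w' := i]" by (auto simp: act_on_word_e_iff)
  then have "active_indices i w = active_indices i w'"
    using active_index_in[OF w(1)] by (simp add: active_indices_update)
  then show "act_on_word letter_f i w = Some w'"
    using w(1,2) active_index_in[OF w(1)] list_update_id[of w' "active_index i w'"]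
    by (simp add: act_on_word_f_iff w(3) active_index_update)
      (simp add: active_indices_def)
qed

section \<open>Weights of words and the crystal axioms for words\<close>

lemma sum_list_update_group:
  fixes xs :: "'a :: ab_group_add list"
  shows "k < length xs \<Longrightarrow> sum_list (xs[k := x]) = sum_list xs - xs ! k + x"
  by (induction xs arbitrary: k) (auto split: nat.split)

lemma lookup_word_weight:
  "Poly_Mapping.lookup (\<Sum>b\<leftarrow>w. eps_vec b) c = int (count_list w c)"
  by (induction w) (auto simp: eps_vec_def lookup_add lookup_single)

text \<open>The coefficient -1 of \<open>eps_vec (plus_half i)\<close> meets the opposite parity
  sign, so both multiplicities enter with the same sign. For the weight of a word they cannot
  cancel, and the pairing detects whether an active letter exists.\<close>

lemma pairing_simple_root:
  "pairing \<mu> (simple_root i) = (if integral i then 1 else - 1) *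
    (Poly_Mapping.lookup \<mu> i + Poly_Mapping.lookup \<mu> (plus_half i))"
proof -
  let ?c = "\<lambda>b. (if integral b then 1 else - 1) * Poly_Mapping.lookup \<mu> b
    * Poly_Mapping.lookup (simple_root i) b"
  have "pairing \<mu> (simple_root i) = sum ?c (Poly_Mapping.keys \<mu> \<union> {i, plus_half i})"
    unfolding pairing_def by (rule sum.mono_neutral_left) (auto simp: in_keys_iff)
  also have "\<dots> = sum ?c {i, plus_half i}"
    by (rule sum.mono_neutral_right)
      (auto simp: simple_root_def eps_vec_def lookup_minus lookup_single when_def)
  finally show ?thesis
    by (auto simp: simple_root_def eps_vec_def lookup_minus lookup_single when_def)
qed

lemma pairing_word_weight_eq_0_iff:
  "pairing (\<Sum>b\<leftarrow>w. eps_vec b) (simple_root i) = 0 \<longleftrightarrow> active_indices i w = {}"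
proof -
  have "pairing (\<Sum>b\<leftarrow>w. eps_vec b) (simple_root i) = 0
      \<longleftrightarrow> count_list w i = 0 \<and> count_list w (plus_half i) = 0"
    by (auto simp: pairing_simple_root lookup_word_weight)
  also have "\<dots> \<longleftrightarrow> active_indices i w = {}"
    by (auto simp: count_list_0_iff active_indices_def in_set_conv_nth)
  finally show ?thesis .
qed

lemma is_crystal_word_crystal: "is_crystal word_crystal"
proof -
  let ?f = "act_on_word letter_f" and ?e = "act_on_word letter_e"
  have wt: "(\<Sum>b\<leftarrow>w'. eps_vec b) = (\<Sum>b\<leftarrow>w. eps_vec b) - simple_root i"
    if "?f i w = Some w'" for i w w'
    using that active_index_in[of i w]
    by (auto simp: act_on_word_f_iff map_update sum_list_update_group simple_root_def
        active_indices_def)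
  have excl: "?e i w = None \<or> ?f i w = None" for i w
    by (auto simp: act_on_word_None_iff letter_e_def letter_f_def)
  \<comment> \<open>The letter at the active index is \<open>i\<close> or
    \<open>plus_half i\<close>, so one of the two operators applies as soon as there is an active
    index; by \<open>excl\<close> the other does not.\<close>
  have act: "active_indices i w = {} \<longleftrightarrow> ?e i w = None \<and> ?f i w = None" for i w
    using active_index_in[of i w]
    by (auto simp: act_on_word_None_iff letter_e_def letter_f_def active_indices_def)
  have fe: "?e i w' \<noteq> None \<and> ?f i w' = None \<and> ?e i w = None" if "?f i w = Some w'" for i w w'
    using that excl[of i w] excl[of i w'] act_on_word_f_iff_e[of i w w'] by auto
  show ?thesis
  proof (rule is_crystalI, goal_cases)
    case (1 i w)
    then show ?case
      using excl[of i w] act[of i w]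
      by (auto simp: word_crystal_def pairing_word_weight_eq_0_iff)
  next
    case (2 i w w')
    then have w': "?f i w' = Some w" by (simp add: word_crystal_def act_on_word_f_iff_e)
    show ?case using wt[OF w'] fe[OF w'] w' by (simp add: word_crystal_def)
  next
    case (3 i w w')
    then have w': "?f i w = Some w'" by (simp add: word_crystal_def)
    show ?case using wt[OF w'] fe[OF w'] w' by (simp add: word_crystal_def)
  next
    case (4 i w w')
    show ?case by (simp add: word_crystal_def act_on_word_f_iff_e)
  qed
qed

section \<open>Words compatible with a descent predicate\<close>

text \<open>Positions in a word are counted from 0, whereas descents are counted from 1: the predicate
  \<open>D\<close> attached to a descent set \<open>X\<close> is \<open>Suc k \<in> X\<close>.\<close>

definition compatible_word :: "(nat \<Rightarrow> bool) \<Rightarrow> halfint list \<Rightarrow> bool" where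
  "compatible_word D a \<longleftrightarrow> (\<forall>k. Suc k < length a \<longrightarrow>
    a ! k \<le> a ! Suc k \<and> (a ! k = a ! Suc k \<longrightarrow> (D k \<longleftrightarrow> \<not> integral (a ! k))))"

text \<open>Within the block of letters \<open>i\<close>, \<open>i + 1/2\<close> of a compatible word, the descents are a
  constant initial segment, then one free value, then the opposite constant.  The position where the
  value switches carries the letter on which the operators act.\<close>

definition turning_position :: "(nat \<Rightarrow> bool) \<Rightarrow> halfint \<Rightarrow> halfint list \<Rightarrow> nat \<Rightarrow> bool" where
  "turning_position D i a k \<longleftrightarrow> k \<in> active_indices i a \<and>
    (\<forall>j\<in>active_indices i a. (j < k \<longrightarrow> (D j \<longleftrightarrow> \<not> integral i)) \<and>
      (k \<le> j \<and> Suc j \<in> active_indices i a \<longrightarrow> (D j \<longleftrightarrow> integral i)))"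

section \<open>Blocks of active letters and their turning positions\<close>

lemma compatible_word_sorted:
  assumes "compatible_word D a" "p \<le> q" "q < length a"
  shows "a ! p \<le> a ! q"
  using assms(2,3)
proof (induction q rule: dec_induct)
  case (step n)
  then show ?case using assms(1) by (fastforce simp: compatible_word_def)
qed simp

lemma compatible_word_block:
  assumes D: "compatible_word D a" and pq: "p \<le> m" "m < q" "q < length a" and eq: "a ! p = a ! q"
  shows "a ! m = a ! p" "D m \<longleftrightarrow> \<not> integral (a ! p)"
proof -
  have "a ! p \<le> a ! m" "a ! m \<le> a ! Suc m" "a ! Suc m \<le> a ! q"
    using compatible_word_sorted[OF D] pq by auto
  then have "a ! m = a ! p" "a ! m = a ! Suc m" using eq by auto
  then show "a ! m = a ! p" "D m \<longleftrightarrow> \<not> integral (a ! p)"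
    using D pq by (auto simp: compatible_word_def)
qed

text \<open>By sortedness, and because no letter lies strictly between \<open>i\<close> and
  \<open>plus_half i\<close>, the block has no gaps; this supports the inductions along it.\<close>

lemma active_indices_convex:
  assumes "compatible_word D a" "j \<in> active_indices i a" "l \<in> active_indices i a" "j \<le> m" "m \<le> l"
  shows "m \<in> active_indices i a"
proof -
  have l: "l < length a" "a ! l \<in> {i, plus_half i}" and j: "a ! j \<in> {i, plus_half i}"
    using assms by (auto simp: active_indices_def)
  have "a ! j \<le> a ! m" "a ! m \<le> a ! l"
    using compatible_word_sorted[OF assms(1)] assms(4,5) l(1) by auto
  then have "i \<le> a ! m" "a ! m \<le> plus_half i"
    using j l(2) order_trans[OF plus_half_le(2)[of i], of "a ! m"]
      order_trans[OF _ plus_half_le(2)[of i], of "a ! m"] by auto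
  then have "a ! m = i \<or> a ! m = plus_half i"
    using plus_half_le_iff[of i "a ! m"] by auto
  then show ?thesis using assms(5) l(1) by (auto simp: active_indices_def)
qed

text \<open>The witness is the largest active position before which every step has the early value.
  At the least active position the condition is vacuous, and maximality gives the step at the
  witness the late value.\<close>

lemma turning_position_exists:
  assumes D: "compatible_word D a" and ne: "active_indices i a \<noteq> {}"
  shows "\<exists>k. turning_position D i a k"
proof -
  let ?A = "active_indices i a"
  let ?K = "{k \<in> ?A. \<forall>j\<in>?A. j < k \<longrightarrow> (D j \<longleftrightarrow> \<not> integral i)}"
  have fin: "finite ?K" by simp
  have "Min ?A \<in> ?K" using Min_in[OF _ ne] Min_le[of ?A] by (force simp: not_less[symmetric])
  define k where "k = Max ?K"
  have "k \<in> ?K" unfolding k_def using Max_in[OF fin] \<open>Min ?A \<in> ?K\<close> by blast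
  then have kA: "k \<in> ?A" and before: "\<forall>j\<in>?A. j < k \<longrightarrow> (D j \<longleftrightarrow> \<not> integral i)"
    by auto
  \<comment> \<open>A step \<open>j\<close> with the late value cannot join two letters
    \<open>i\<close>, so \<open>a ! Suc j\<close> is \<open>plus_half i\<close>. The next step then
    joins two letters \<open>plus_half i\<close>, where compatibility forces the late value
    again.\<close>
  have propagate: "D (Suc j) \<longleftrightarrow> integral i"
    if j: "j \<in> ?A" "Suc j \<in> ?A" "Suc (Suc j) \<in> ?A" "D j \<longleftrightarrow> integral i" for j
  proof -
    have "Suc (Suc j) < length a" using j by (simp add: active_indices_def)
    then have "a ! j \<le> a ! Suc j" "a ! j = a ! Suc j \<longrightarrow> (D j \<longleftrightarrow> \<not> integral (a ! j))"
      "a ! Suc j \<le> a ! Suc (Suc j)"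
      "a ! Suc j = a ! Suc (Suc j) \<longrightarrow> (D (Suc j) \<longleftrightarrow> \<not> integral (a ! Suc j))"
      using D by (simp_all add: compatible_word_def)
    then show ?thesis
      using j less_plus_half[of i] by (auto simp: active_indices_def)
  qed
  have first: "D k \<longleftrightarrow> integral i" if "Suc k \<in> ?A"
  proof (rule ccontr)
    assume "\<not> (D k \<longleftrightarrow> integral i)"
    then have "Suc k \<in> ?K" using before that by (auto simp: less_Suc_eq)
    then have "Suc k \<le> Max ?K" by (rule Max_ge[OF fin])
    then show False by (simp add: k_def)
  qed
  have later: "D j \<longleftrightarrow> integral i" if "k \<le> j" "Suc j \<in> ?A" for j
    using that
  proof (induction j rule: dec_induct)
    case base
    then show ?case using first by simp
  next
    case (step n)
    have "n \<in> ?A" "Suc n \<in> ?A"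
      using active_indices_convex[OF D kA step.prems] step.hyps by auto
    then show ?case using \<open>Suc (Suc n) \<in> ?A\<close> step.IH propagate by blast
  qed
  have "turning_position D i a k"
    unfolding turning_position_def using kA before later by blast
  then show ?thesis ..
qed

lemma active_index_turning_position:
  assumes D: "compatible_word D a" and turn: "turning_position D i a k"
    and pos: "bij_betw pos {..<length a} {..<length w}"
    and w: "\<And>m. m < length a \<Longrightarrow> w ! pos m = a ! m"
    and desc: "\<And>m. Suc m < length a \<Longrightarrow> D m \<longleftrightarrow> pos m < pos (Suc m)"
  shows "active_index i w = pos k"
proof -
  let ?A = "active_indices i a"
  \<comment> \<open>The sign turns the search for a maximum, for odd \<open>i\<close>, into one for
    a minimum: in both cases \<open>f\<close> falls up to \<open>k\<close> and rises from there
    on.\<close>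
  define f where "f m = (if integral i then int (pos m) else - int (pos m))" for m
  have kA: "k \<in> ?A" using turn by (simp add: turning_position_def)
  have lt: "(D m \<longleftrightarrow> integral i) \<longleftrightarrow> f m < f (Suc m)" if "Suc m < length a" for m
  proof -
    have "pos m \<noteq> pos (Suc m)"
      using that inj_on_contraD[OF bij_betw_imp_inj_on[OF pos], of m "Suc m"] by auto
    then show ?thesis using desc[OF that] by (auto simp: f_def)
  qed
  have up: "f k \<le> f j" if "k \<le> j" "j \<in> ?A" for j
    using that
  proof (induction j rule: dec_induct)
    case (step n)
    then have n: "n \<in> ?A" using active_indices_convex[OF D kA, of "Suc n" n] by simp
    then have "D n \<longleftrightarrow> integral i" using turn step by (auto simp: turning_position_def)
    then have "f n < f (Suc n)" using lt step.prems by (simp add: active_indices_def)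
    then show ?case using step.IH n by simp
  qed simp
  have down: "f k \<le> f j" if "j \<le> k" "j \<in> ?A" for j
    using that
  proof (induction j rule: inc_induct)
    case (step n)
    then have n: "Suc n \<in> ?A" using active_indices_convex[OF D _ kA, of n "Suc n"] by simp
    have "\<not> (D n \<longleftrightarrow> integral i)" using turn step by (auto simp: turning_position_def)
    then have "f (Suc n) \<le> f n" using lt[of n] n by (simp add: active_indices_def)
    then show ?case using step.IH n by simp
  qed simp
  have min: "f k \<le> f j" if "j \<in> ?A" for j
    using up[of j] down[of j] that by linarith
  have A: "active_indices i w = pos ` ?A"
  proof (intro equalityI subsetI)
    fix p assume p: "p \<in> active_indices i w"
    then have "p \<in> pos ` {..<length a}"
      using bij_betw_imp_surj_on[OF pos] by (simp add: active_indices_def)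
    then obtain m where "m < length a" "p = pos m" by auto
    then show "p \<in> pos ` ?A" using p w by (auto simp: active_indices_def)
  next
    fix p assume "p \<in> pos ` ?A"
    then show "p \<in> active_indices i w"
      using w bij_betwE[OF pos] by (auto simp: active_indices_def)
  qed
  show ?thesis
  proof (cases "integral i")
    case True
    have "Min (pos ` ?A) = pos k"
      using min kA True by (intro Min_eqI) (auto simp: f_def)
    then show ?thesis using True by (simp add: active_index_def A)
  next
    case False
    have "Max (pos ` ?A) = pos k"
      using min kA False by (intro Max_eqI) (auto simp: f_def)
    then show ?thesis using False by (simp add: active_index_def A)
  qed
qed

text \<open>If \<open>a ! k = i\<close>, the step after \<open>k\<close> has a value that excludes a
  further \<open>i\<close> and suits a following \<open>plus_half i\<close>. If
  \<open>a ! k = plus_half i\<close>, the step before \<open>k\<close> excludes a preceding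
  \<open>plus_half i\<close> and suits a preceding \<open>i\<close>.\<close>

lemma compatible_word_update:
  assumes D: "compatible_word D a" and turn: "turning_position D i a k"
    and b: "a ! k = i \<and> b = plus_half i \<or> a ! k = plus_half i \<and> b = i"
  shows "compatible_word D (a[k := b])"
proof -
  have kA: "k \<in> active_indices i a" and k: "k < length a"
    using turn by (auto simp: turning_position_def active_indices_def)
  have prev: "a ! m \<le> b \<and> (a ! m = b \<longrightarrow> (D m \<longleftrightarrow> \<not> integral b))" if "Suc m = k" for m
  proof -
    have m: "a ! m \<le> a ! k" "a ! m = a ! k \<longrightarrow> (D m \<longleftrightarrow> \<not> integral (a ! k))"
      using D that k by (auto simp: compatible_word_def)
    have "D m \<longleftrightarrow> \<not> integral i" if "m \<in> active_indices i a"
      using turn that \<open>Suc m = k\<close> by (auto simp: turning_position_def)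
    then have m': "a ! m \<in> {i, plus_half i} \<longrightarrow> (D m \<longleftrightarrow> \<not> integral i)"
      using that k by (auto simp: active_indices_def)
    show ?thesis
      using b m m' less_plus_half[of i] plus_half_le_iff[of i "a ! m"] by auto
  qed
  have succ: "b \<le> a ! Suc k \<and> (b = a ! Suc k \<longrightarrow> (D k \<longleftrightarrow> \<not> integral b))"
    if "Suc k < length a"
  proof -
    have m: "a ! k \<le> a ! Suc k" "a ! k = a ! Suc k \<longrightarrow> (D k \<longleftrightarrow> \<not> integral (a ! k))"
      using D that by (auto simp: compatible_word_def)
    have "D k \<longleftrightarrow> integral i" if "Suc k \<in> active_indices i a"
      using turn that kA by (auto simp: turning_position_def)
    then have m': "a ! Suc k \<in> {i, plus_half i} \<longrightarrow> (D k \<longleftrightarrow> integral i)"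
      using that by (auto simp: active_indices_def)
    show ?thesis
      using b m m' less_plus_half[of i] plus_half_le_iff[of i "a ! Suc k"]
        integral_plus_half[of i] by (auto simp del: integral_plus_half)
  qed
  show ?thesis
    unfolding compatible_word_def
  proof (intro allI impI)
    fix m assume m: "Suc m < length (a[k := b])"
    then show "a[k := b] ! m \<le> a[k := b] ! Suc m \<and> (a[k := b] ! m = a[k := b] ! Suc m \<longrightarrow>
        (D m \<longleftrightarrow> \<not> integral (a[k := b] ! m)))"
      using prev[of m] succ D k by (auto simp: nth_list_update compatible_word_def)
  qed
qed

text \<open>The result is a position with its new letter, not a new word, so that the same outcome
  can be replayed on fillings of two different diagrams.\<close>

definition sequence_action ::
  "(halfint \<Rightarrow> halfint \<Rightarrow> halfint option) \<Rightarrow> (nat \<Rightarrow> bool) \<Rightarrow> halfint \<Rightarrow> halfint list \<Rightarrow>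
    (nat \<times> halfint) option" where
  "sequence_action g D i a =
    (if active_indices i a = {} then None
     else let k = (SOME k. turning_position D i a k) in map_option (Pair k) (g i (a ! k)))"

lemma sequence_action_compatible:
  assumes D: "compatible_word D a" and act: "sequence_action g D i a = Some (k, b)"
    and g: "g = letter_e \<or> g = letter_f"
  shows "k < length a \<and> compatible_word D (a[k := b])"
proof -
  have ne: "active_indices i a \<noteq> {}" and k: "k = (SOME k. turning_position D i a k)"
    and b: "g i (a ! k) = Some b"
    using act by (auto simp: sequence_action_def Let_def split: if_splits)
  have turn: "turning_position D i a k"
    unfolding k by (rule someI_ex[OF turning_position_exists[OF D ne]])
  show ?thesis
    using compatible_word_update[OF D turn, of b] turn b g
    by (auto simp: letter_e_def letter_f_def turning_position_def active_indices_def
        split: if_splits)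
qed

section \<open>Fillings read in two orders\<close>

definition reading_descents :: "'n list \<Rightarrow> 'n list \<Rightarrow> (nat \<Rightarrow> bool) \<Rightarrow> bool" where
  "reading_descents ns reading D \<longleftrightarrow> distinct ns \<and> distinct reading \<and> set ns = set reading \<and>
    (\<forall>k p q. Suc k < length ns \<longrightarrow> p < length reading \<longrightarrow> q < length reading \<longrightarrow>
      reading ! p = ns ! k \<longrightarrow> reading ! q = ns ! Suc k \<longrightarrow> (D k \<longleftrightarrow> p < q))"

text \<open>The right-hand side consults the reading only to write down the result: what changes is
  determined by \<open>D\<close> and the word of entries. The turning position is carried to the
  active index, and since \<open>reading\<close> is distinct, changing the filling at one node
  changes one letter.\<close>

lemma act_on_word_reading:
  assumes rd: "reading_descents ns reading D" and D: "compatible_word D (map T ns)"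
  shows "act_on_word g i (map T reading) =
    map_option (\<lambda>(k, b). map (T(ns ! k := b)) reading) (sequence_action g D i (map T ns))"
proof -
  let ?a = "map T ns" and ?w = "map T reading"
  have ns: "distinct ns" "distinct reading" "set ns = set reading"
    using rd by (auto simp: reading_descents_def)
  define pos where "pos k = inv_into {..<length reading} ((!) reading) (ns ! k)" for k
  have img: "(!) xs ` {..<length xs} = set xs" for xs :: "'a list"
    by (auto simp: in_set_conv_nth)
  have bij: "bij_betw ((!) xs) {..<length xs} (set xs)" if "distinct xs" for xs :: "'a list"
    using that by (auto simp: bij_betw_def inj_on_nth img)
  have pos: "bij_betw pos {..<length ?a} {..<length ?w}"
    using bij_betw_trans[OF bij[OF ns(1), unfolded ns(3)] bij_betw_inv_into[OF bij[OF ns(2)]]]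
    by (simp add: pos_def[abs_def] comp_def)
  have pos_nth: "reading ! pos k = ns ! k" "pos k < length reading" if "k < length ns" for k
  proof -
    have "ns ! k \<in> (!) reading ` {..<length reading}" using that ns(3) img by auto
    from f_inv_into_f[OF this] inv_into_into[OF this]
    show "reading ! pos k = ns ! k" "pos k < length reading" by (auto simp: pos_def)
  qed
  have w: "?w ! pos m = ?a ! m" if "m < length ?a" for m
    using that pos_nth by simp
  have desc: "D m \<longleftrightarrow> pos m < pos (Suc m)" if "Suc m < length ?a" for m
    using rd that pos_nth[of m] pos_nth[of "Suc m"]
    unfolding reading_descents_def by auto
  have empty: "active_indices i ?w = {} \<longleftrightarrow> active_indices i ?a = {}"
  proof -
    have "active_indices i v = {} \<longleftrightarrow> i \<notin> set v \<and> plus_half i \<notin> set v" for v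
      by (auto simp: active_indices_def in_set_conv_nth)
    then show ?thesis using ns(3) by simp
  qed
  show ?thesis
  proof (cases "active_indices i ?a = {}")
    case True
    then show ?thesis using empty by (simp add: sequence_action_def act_on_word_def)
  next
    case False
    define k where "k = (SOME k. turning_position D i ?a k)"
    have turn: "turning_position D i ?a k"
      unfolding k_def by (rule someI_ex[OF turning_position_exists[OF D False]])
    then have k: "k < length ns" by (auto simp: turning_position_def active_indices_def)
    have "reading ! p = ns ! k \<longleftrightarrow> p = pos k" if "p < length reading" for p
      using that pos_nth[OF k] nth_eq_iff_index_eq[OF ns(2)] by metis
    then have "?w[pos k := b] = map (T(ns ! k := b)) reading" for b
      by (intro nth_equalityI) (auto simp: nth_list_update)
    then show ?thesis
      using False empty active_index_turning_position[OF D turn pos w desc] w[of k] k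
      by (cases "g i (T (ns ! k))")
        (simp_all add: sequence_action_def act_on_word_def k_def[symmetric]
          active_index_def[symmetric] Let_def)
  qed
qed

section \<open>Young diagrams and standard tableaux\<close>

lemma young_diagram_closed:
  assumes "is_partition lam" "(i, j) \<in> young_diagram lam" "i' \<le> i" "j' \<le> j"
  shows "(i', j') \<in> young_diagram lam"
proof -
  have "lam ! i \<le> lam ! i'"
    using assms sorted_wrt_nth_less[of "(\<ge>)" lam i' i]
    by (cases "i' = i") (auto simp: is_partition_def young_diagram_def)
  then show ?thesis using assms by (auto simp: young_diagram_def)
qed

lemma young_diagram_Sigma: "young_diagram lam = Sigma {..<length lam} (\<lambda>i. {..<lam ! i})"
  by (auto simp: young_diagram_def)

lemma finite_young_diagram [simp]: "finite (young_diagram lam)"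
  by (simp add: young_diagram_Sigma)

lemma card_young_diagram: "card (young_diagram lam) = sum_list lam"
  by (simp add: young_diagram_Sigma sum_list_sum_nth atLeast0LessThan)

definition standard_nodes :: "nat list \<Rightarrow> (node \<Rightarrow> nat) \<Rightarrow> node list" where
  "standard_nodes lam S = map (\<lambda>k. node_of lam S (Suc k)) [0..<sum_list lam]"

lemma length_standard_nodes [simp]: "length (standard_nodes lam S) = sum_list lam"
  by (simp add: standard_nodes_def)

section \<open>Nodes of a standard tableau in the order of their labels\<close>

context
  fixes lam S
  assumes S: "S \<in> standard_tableaux lam"
begin

lemma standard_bij: "bij_betw S (young_diagram lam) {1..sum_list lam}"
  using S by (simp add: standard_tableaux_def)

lemma standard_nodes_nth:
  assumes "k < sum_list lam"
  shows "standard_nodes lam S ! k \<in> young_diagram lam" "S (standard_nodes lam S ! k) = Suc k"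
proof -
  have "Suc k \<in> S ` young_diagram lam"
    using assms bij_betw_imp_surj_on[OF standard_bij] by auto
  from inv_into_into[OF this] f_inv_into_f[OF this]
  show "standard_nodes lam S ! k \<in> young_diagram lam" "S (standard_nodes lam S ! k) = Suc k"
    using assms by (auto simp: standard_nodes_def node_of_def)
qed

lemma standard_range: "n \<in> young_diagram lam \<Longrightarrow> 1 \<le> S n \<and> S n \<le> sum_list lam"
  using bij_betwE[OF standard_bij] by auto

lemma standard_nodes_inverse:
  "n \<in> young_diagram lam \<Longrightarrow> standard_nodes lam S ! (S n - 1) = n"
  using standard_range[of n] inv_into_f_f[OF bij_betw_imp_inj_on[OF standard_bij], of n]
  by (cases "S n") (simp_all add: standard_nodes_def node_of_def)

lemma standard_nodes_eq_iff:
  "k < sum_list lam \<Longrightarrow> l < sum_list lam \<Longrightarrow>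
    standard_nodes lam S ! k = standard_nodes lam S ! l \<longleftrightarrow> k = l"
  by (metis Suc_inject standard_nodes_nth(2))

lemma distinct_standard_nodes: "distinct (standard_nodes lam S)"
  by (simp add: distinct_conv_nth standard_nodes_eq_iff)

lemma set_standard_nodes: "set (standard_nodes lam S) = young_diagram lam"
proof (intro equalityI subsetI)
  fix n assume n: "n \<in> young_diagram lam"
  then have "S n - 1 < length (standard_nodes lam S)" using standard_range[OF n] by auto
  then show "n \<in> set (standard_nodes lam S)"
    using standard_nodes_inverse[OF n] nth_mem by metis
next
  fix n assume "n \<in> set (standard_nodes lam S)"
  then obtain k where "k < sum_list lam" "standard_nodes lam S ! k = n"
    by (auto simp: in_set_conv_nth)
  then show "n \<in> young_diagram lam" using standard_nodes_nth(1) by metis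
qed

lemma mem_descent_set_iff:
  "Suc k < sum_list lam \<Longrightarrow> Suc k \<in> descent_set lam S \<longleftrightarrow>
    snd (standard_nodes lam S ! Suc k) \<le> snd (standard_nodes lam S ! k)"
  by (auto simp: descent_set_def standard_nodes_def)

context
  assumes lam: "is_partition lam"
begin

text \<open>Move right along the row of \<open>n\<close>, then down the column of \<open>m\<close>;
  the corner lies in the diagram because it is weakly above \<open>m\<close>.\<close>

lemma standard_mono:
  assumes m: "m \<in> young_diagram lam" and le: "fst n \<le> fst m" "snd n \<le> snd m" and ne: "n \<noteq> m"
  shows "S n < S m"
proof -
  obtain i j i' j' where ij: "n = (i, j)" "m = (i', j')" by force
  have Y: "(i, j) \<in> young_diagram lam" "(i, j') \<in> young_diagram lam"
    using young_diagram_closed[OF lam] m le ij by auto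
  have "S (i, j) < S (i, j')" if "j < j'"
    using S Y that unfolding standard_tableaux_def by blast
  then have "S (i, j) \<le> S (i, j')" using le ij by (cases "j = j'") auto
  moreover have "S (i, j') < S (i', j')" if "i < i'"
    using S Y(2) m ij that unfolding standard_tableaux_def by blast
  then have "S (i, j') \<le> S (i', j')" using le ij by (cases "i = i'") auto
  moreover have "S (i, j) \<noteq> S (i', j')"
    using inj_onD[OF bij_betw_imp_inj_on[OF standard_bij]] Y(1) m ne ij by auto
  ultimately show ?thesis using ij by auto
qed

text \<open>A label smaller by one cannot sit strictly above and strictly to the left: the corner
  \<open>(fst n, snd m)\<close> would need a label strictly in between. Nor can the larger label sit
  weakly above and weakly to the left.\<close>

lemma standard_nodes_rows:
  assumes k: "Suc k < sum_list lam"
  defines "n \<equiv> standard_nodes lam S ! k" and "m \<equiv> standard_nodes lam S ! Suc k"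
  shows "snd m \<le> snd n \<Longrightarrow> fst n < fst m" and "snd n < snd m \<Longrightarrow> fst m \<le> fst n"
proof -
  have n: "n \<in> young_diagram lam" "S n = Suc k" and m: "m \<in> young_diagram lam" "S m = Suc (Suc k)"
    using standard_nodes_nth[of k] standard_nodes_nth[of "Suc k"] k by (simp_all add: n_def m_def)
  then have ne: "n \<noteq> m" by auto
  show "fst n < fst m" if "snd m \<le> snd n"
    using standard_mono[OF n(1), of m] that ne n m by force
  show "fst m \<le> fst n" if "snd n < snd m"
  proof (rule ccontr)
    assume "\<not> fst m \<le> fst n"
    then have lt: "fst n < fst m" by simp
    let ?x = "(fst n, snd m)"
    have "?x \<in> young_diagram lam"
      using young_diagram_closed[OF lam, of "fst m" "snd m"] m(1) lt by simp
    then have "S n < S ?x" "S ?x < S m"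
      using standard_mono[of ?x n] standard_mono[OF m(1), of ?x] lt that
      by (force simp: prod_eq_iff)+
    then show False using n m by simp
  qed
qed

text \<open>Admissibility compares neighbours only. Chaining them inside the diagram shows that a
  node is read before every other node weakly below and weakly to the left of it, and by
  \<open>standard_nodes_rows\<close> two consecutive labels are always placed this way, in one order
  or the other.\<close>

lemma standard_reading_descents:
  assumes adm: "admissible_reading (young_diagram lam) reading"
  shows "reading_descents (standard_nodes lam S) reading (\<lambda>k. Suc k \<in> descent_set lam S)"
proof -
  let ?ns = "standard_nodes lam S"
  have dist: "distinct reading" and set: "set reading = young_diagram lam"
    using adm by (auto simp: admissible_reading_def)
  have adj: "p < q" if "p < length reading" "q < length reading" "reading ! p = (i, j)"
      "reading ! q = (i + 1, j) \<or> 0 < j \<and> reading ! q = (i, j - 1)" for p q i j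
    using adm that unfolding admissible_reading_def by blast
  have left: "p < q" if "p < length reading" "q < length reading" "reading ! p = (i, j)"
      "reading ! q = (i, j')" "j' < j" for p q i j j'
    using that
  proof (induction j arbitrary: p)
    case (Suc j)
    show ?case
    proof (cases "j' = j")
      case True
      then show ?thesis using adj[of p q i "Suc j"] Suc.prems by simp
    next
      case False
      have "(i, Suc j) \<in> young_diagram lam" using Suc.prems set nth_mem by metis
      then have "(i, j) \<in> set reading" using young_diagram_closed[OF lam] set by auto
      then obtain s where s: "s < length reading" "reading ! s = (i, j)"
        by (auto simp: in_set_conv_nth)
      then have "p < s" using adj[of p s i "Suc j"] Suc.prems by simp
      moreover have "s < q" using Suc.IH[OF s(1) _ s(2)] Suc.prems False by simp
      ultimately show ?thesis by simp
    qed
  qed simp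
  have down: "p < q" if "p < length reading" "q < length reading" "reading ! p = (i, j)"
      "reading ! q = (i', j)" "i < i'" for p q i i' j
    using that
  proof (induction i' arbitrary: q)
    case (Suc i')
    show ?case
    proof (cases "i' = i")
      case True
      then show ?thesis using adj[of p q i j] Suc.prems by simp
    next
      case False
      have "(Suc i', j) \<in> young_diagram lam" using Suc.prems set nth_mem by metis
      then have "(i', j) \<in> set reading" using young_diagram_closed[OF lam] set by auto
      then obtain s where s: "s < length reading" "reading ! s = (i', j)"
        by (auto simp: in_set_conv_nth)
      then have "s < q" using adj[of s q i' j] Suc.prems by simp
      moreover have "p < s" using Suc.IH[OF _ s(1) _ s(2)] Suc.prems False by simp
      ultimately show ?thesis by simp
    qed
  qed simp
  have before: "p < q" if p: "p < length reading" "reading ! p = (i, j)"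
    and q: "q < length reading" "reading ! q = (i', j')"
    and le: "i \<le> i'" "j' \<le> j" and ne: "(i, j) \<noteq> (i', j')" for p q i j i' j'
  proof -
    have "(i, j) \<in> young_diagram lam" using p set nth_mem by metis
    then have "(i, j') \<in> set reading" using young_diagram_closed[OF lam] set le by auto
    then obtain s where s: "s < length reading" "reading ! s = (i, j')"
      by (auto simp: in_set_conv_nth)
    have "p \<le> s"
      using left[OF p(1) s(1) p(2) s(2)] le p s dist nth_eq_iff_index_eq[OF dist p(1) s(1)]
      by (cases "j = j'") auto
    moreover have "s \<le> q"
      using down[OF s(1) q(1) s(2) q(2)] le q s dist nth_eq_iff_index_eq[OF dist s(1) q(1)]
      by (cases "i = i'") auto
    moreover have "p \<noteq> q" using p q ne by auto
    ultimately show ?thesis by simp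
  qed
  have "Suc k \<in> descent_set lam S \<longleftrightarrow> p < q"
    if k: "Suc k < sum_list lam" and p: "p < length reading" "reading ! p = ?ns ! k"
      and q: "q < length reading" "reading ! q = ?ns ! Suc k" for k p q
  proof -
    have ne: "?ns ! k \<noteq> ?ns ! Suc k" using standard_nodes_eq_iff k by simp
    show ?thesis
      using before[of p "fst (?ns ! k)" "snd (?ns ! k)" q "fst (?ns ! Suc k)" "snd (?ns ! Suc k)"]
        before[of q "fst (?ns ! Suc k)" "snd (?ns ! Suc k)" p "fst (?ns ! k)" "snd (?ns ! k)"]
        standard_nodes_rows[OF k] mem_descent_set_iff[OF k] p q ne
      by (simp add: prod_eq_iff) linarith
  qed
  then show ?thesis
    using dist set by (simp add: reading_descents_def distinct_standard_nodes set_standard_nodes)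
qed

end

end

section \<open>Standardization\<close>

text \<open>Equal integers form a horizontal strip, numbered from left to right; equal odd half-integers
  form a vertical strip, numbered from top to bottom.\<close>

definition standard_less :: "(node \<Rightarrow> halfint) \<Rightarrow> node \<Rightarrow> node \<Rightarrow> bool" where
  "standard_less T n m \<longleftrightarrow> T n < T m \<or>
    T n = T m \<and> (if integral (T n) then snd n < snd m else fst n < fst m)"

definition standardization :: "node set \<Rightarrow> (node \<Rightarrow> halfint) \<Rightarrow> node \<Rightarrow> nat" where
  "standardization R T = (\<lambda>n\<in>R. Suc (card {m \<in> R. standard_less T m n}))"

lemma standard_less_trans: "standard_less T n m \<Longrightarrow> standard_less T m l \<Longrightarrow> standard_less T n l"
  by (auto simp: standard_less_def split: if_splits)

lemma standard_less_irrefl: "\<not> standard_less T n n"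
  by (simp add: standard_less_def)

section \<open>Uniqueness: a filling compatible with \<open>S\<close> has standardization
  \<open>S\<close>\<close>

context
  fixes lam
  assumes lam: "is_partition lam"
begin

text \<open>Between equal entries all steps are descents or all are non-descents, so a run of
  integers moves right at each step, and a run of odd letters moves down at each step.\<close>

lemma compatible_imp_block:
  assumes S: "S \<in> standard_tableaux lam"
    and D: "compatible_word (\<lambda>k. Suc k \<in> descent_set lam S) (map T (standard_nodes lam S))"
    and n: "n \<in> young_diagram lam" and m: "m \<in> young_diagram lam" and less: "S n < S m"
  shows "T n < T m \<or> T n = T m \<and>
    (if integral (T n) then snd n < snd m else fst n < fst m \<and> snd m \<le> snd n)"
proof -
  let ?ns = "standard_nodes lam S"
  define p q where "p = S n - 1" and "q = S m - 1"
  have pq: "p < q" "q < sum_list lam" and ns: "?ns ! p = n" "?ns ! q = m"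
    using standard_range[OF S n] standard_range[OF S m] less standard_nodes_inverse[OF S] n m
    by (auto simp: p_def q_def)
  have le: "T n \<le> T m" using compatible_word_sorted[OF D, of p q] pq ns by simp
  have "if integral (T n) then snd n < snd m else fst n < fst m \<and> snd m \<le> snd n" if "T n = T m"
  proof -
    have desc: "Suc k \<in> descent_set lam S \<longleftrightarrow> \<not> integral (T n)" if "p \<le> k" "k < q" for k
      using compatible_word_block(2)[OF D that] pq ns \<open>T n = T m\<close> by simp
    have q: "Suc p \<le> q" using pq by simp
    have "if integral (T n) then snd (?ns ! p) < snd (?ns ! q)
      else fst (?ns ! p) < fst (?ns ! q) \<and> snd (?ns ! q) \<le> snd (?ns ! p)"
      using q order_refl[of q]
    proof (induction "q" rule: dec_induct)
      case base
      then show ?case using desc[of p] mem_descent_set_iff[OF S, of p]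
          standard_nodes_rows[OF S lam, of p] pq
        by (auto simp: not_le)
    next
      case (step k)
      then show ?case using desc[of k] mem_descent_set_iff[OF S, of k]
          standard_nodes_rows[OF S lam, of k] pq
        by (auto simp: not_le split: if_splits)
    qed
    then show ?thesis unfolding ns .
  qed
  then show ?thesis using le by auto
qed

text \<open>Equal integers in one column, or equal odd letters in one row, would contradict the
  direction in which their run moves.\<close>

lemma compatible_imp_tableau:
  assumes S: "S \<in> standard_tableaux lam" and T: "T \<in> young_diagram lam \<rightarrow>\<^sub>E UNIV"
    and D: "compatible_word (\<lambda>k. Suc k \<in> descent_set lam S) (map T (standard_nodes lam S))"
  shows "T \<in> tableaux (young_diagram lam)"
proof -
  note block = compatible_imp_block[OF S D]
  have row: "T (i, j) \<le> T (i, j') \<and> (\<not> integral (T (i, j)) \<longrightarrow> T (i, j) < T (i, j'))"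
    if "(i, j) \<in> young_diagram lam" "(i, j') \<in> young_diagram lam" "j < j'" for i j j'
    using block[OF that(1,2)] standard_mono[OF S lam that(2), of "(i, j)"] that(3)
    by (auto split: if_splits)
  have col: "T (i, j) \<le> T (i', j) \<and> (integral (T (i, j)) \<longrightarrow> T (i, j) < T (i', j))"
    if "(i, j) \<in> young_diagram lam" "(i', j) \<in> young_diagram lam" "i < i'" for i i' j
    using block[OF that(1,2)] standard_mono[OF S lam that(2), of "(i, j)"] that(3)
    by (auto split: if_splits)
  show ?thesis unfolding tableaux_def using T row col by blast
qed

text \<open>\<open>S\<close> and \<open>standard_less T\<close> order the nodes alike: one
  implication is \<open>compatible_imp_block\<close>, the other follows since \<open>S\<close> is
  injective and \<open>standard_less\<close> is asymmetric. Thus \<open>S\<close> can be recovered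
  from \<open>T\<close>, and the summands do not overlap.\<close>

lemma compatible_imp_standardization:
  assumes S: "S \<in> standard_tableaux lam"
    and D: "compatible_word (\<lambda>k. Suc k \<in> descent_set lam S) (map T (standard_nodes lam S))"
  shows "standardization (young_diagram lam) T = S"
proof
  fix n
  let ?Y = "young_diagram lam"
  show "standardization ?Y T n = S n"
  proof (cases "n \<in> ?Y")
    case True
    have less: "S m < S n \<longleftrightarrow> standard_less T m n" if m: "m \<in> ?Y" for m
    proof -
      have imp: "standard_less T x y" if "x \<in> ?Y" "y \<in> ?Y" "S x < S y" for x y
        using compatible_imp_block[OF S D that] by (auto simp: standard_less_def split: if_splits)
      have "m = n" if "S m = S n"
        using inj_onD[OF bij_betw_imp_inj_on[OF standard_bij[OF S]] that m True] .
      then show ?thesis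
        using imp[OF m True] imp[OF True m] standard_less_trans[of T m n m]
          standard_less_irrefl[of T] by (metis linorder_neqE_nat)
    qed
    have "S ` {m \<in> ?Y. S m < S n} = {1..<S n}"
    proof (intro equalityI subsetI)
      fix x assume x: "x \<in> {1..<S n}"
      then have "x \<in> S ` ?Y"
        using bij_betw_imp_surj_on[OF standard_bij[OF S]] standard_range[OF S True] by auto
      then show "x \<in> S ` {m \<in> ?Y. S m < S n}" using x by auto
    qed (use standard_range[OF S] in auto)
    moreover have "inj_on S {m \<in> ?Y. S m < S n}"
      using bij_betw_imp_inj_on[OF standard_bij[OF S]] by (rule inj_on_subset) auto
    ultimately have "card {m \<in> ?Y. S m < S n} = S n - 1"
      using card_image by fastforce
    moreover have "{m \<in> ?Y. S m < S n} = {m \<in> ?Y. standard_less T m n}" using less by auto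
    ultimately show ?thesis using True standard_range[OF S True] by (simp add: standardization_def)
  next
    case False
    have "S \<in> ?Y \<rightarrow>\<^sub>E UNIV" using S unfolding standard_tableaux_def by blast
    then show ?thesis using False PiE_arb[of S ?Y _ n] by (simp add: standardization_def)
  qed
qed

section \<open>Existence: a tableau is compatible with its standardization\<close>

context
  fixes T
  assumes T: "T \<in> tableaux (young_diagram lam)"
begin

lemma tableau_row:
  "(i, j) \<in> young_diagram lam \<Longrightarrow> (i, j') \<in> young_diagram lam \<Longrightarrow> j < j' \<Longrightarrow>
    T (i, j) \<le> T (i, j') \<and> (\<not> integral (T (i, j)) \<longrightarrow> T (i, j) < T (i, j'))"
  using T unfolding tableaux_def by blast

lemma tableau_column:
  "(i, j) \<in> young_diagram lam \<Longrightarrow> (i', j) \<in> young_diagram lam \<Longrightarrow> i < i' \<Longrightarrow>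
    T (i, j) \<le> T (i', j) \<and> (integral (T (i, j)) \<longrightarrow> T (i, j) < T (i', j))"
  using T unfolding tableaux_def by blast

text \<open>Incomparable nodes would carry equal integers in one column or equal odd letters in one
  row, which strictness excludes.\<close>

lemma standard_less_total:
  assumes n: "n \<in> young_diagram lam" and m: "m \<in> young_diagram lam" and ne: "n \<noteq> m"
  shows "standard_less T n m \<or> standard_less T m n"
proof (rule ccontr)
  assume "\<not> ?thesis"
  then have eq: "T n = T m" "if integral (T n) then snd n = snd m else fst n = fst m"
    by (auto simp: standard_less_def split: if_splits)
  obtain i j i' j' where ij: "n = (i, j)" "m = (i', j')" by force
  show False
  proof (cases "integral (T n)")
    case True
    then show False
      using tableau_column[of i j i'] tableau_column[of i' j i] n m ne ij eq
      by (cases i i' rule: linorder_cases) auto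
  next
    case False
    then show False
      using tableau_row[of i j j'] tableau_row[of i j' j] n m ne ij eq
      by (cases j j' rule: linorder_cases) auto
  qed
qed

lemma standardization_less_iff:
  assumes n: "n \<in> young_diagram lam" and m: "m \<in> young_diagram lam"
  shows "standardization (young_diagram lam) T n < standardization (young_diagram lam) T m
    \<longleftrightarrow> standard_less T n m"
proof -
  let ?Y = "young_diagram lam" and ?s = "standardization (young_diagram lam) T"
  have mono: "?s x < ?s y" if "x \<in> ?Y" "y \<in> ?Y" "standard_less T x y" for x y
  proof -
    have "{z \<in> ?Y. standard_less T z x} \<subset> {z \<in> ?Y. standard_less T z y}"
      using that standard_less_trans[of T _ x y] standard_less_irrefl[of T x] by blast
    then have "card {z \<in> ?Y. standard_less T z x} < card {z \<in> ?Y. standard_less T z y}"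
      by (intro psubset_card_mono) auto
    then show ?thesis using that by (simp add: standardization_def)
  qed
  show ?thesis
    using mono[OF n m] mono[OF m n] standard_less_total[OF n m] by (cases "n = m") auto
qed

lemma standardization_standard: "standardization (young_diagram lam) T \<in> standard_tableaux lam"
proof -
  let ?Y = "young_diagram lam" and ?s = "standardization (young_diagram lam) T"
  have inj: "inj_on ?s ?Y"
    using standardization_less_iff standard_less_total
    by (intro inj_onI) (metis less_irrefl)
  have "?s n \<in> {1..sum_list lam}" if n: "n \<in> ?Y" for n
  proof -
    have "{m \<in> ?Y. standard_less T m n} \<subset> ?Y" using n standard_less_irrefl[of T n] by blast
    then have "card {m \<in> ?Y. standard_less T m n} < card ?Y" by (intro psubset_card_mono) auto
    then show ?thesis using n by (simp add: standardization_def card_young_diagram)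
  qed
  \<comment> \<open>The ranks are distinct and lie in a set with as many elements as the diagram has
    nodes, so they exhaust it.\<close>
  then have "?s ` ?Y = {1..sum_list lam}"
    using card_image[OF inj] by (intro card_subset_eq) (auto simp: card_young_diagram)
  then have bij: "bij_betw ?s ?Y {1..sum_list lam}" using inj by (simp add: bij_betw_def)
  have row: "?s (i, j) < ?s (i, j')" if "(i, j) \<in> ?Y" "(i, j') \<in> ?Y" "j < j'" for i j j'
    using tableau_row[OF that] that standardization_less_iff[OF that(1,2)]
    by (auto simp: standard_less_def)
  have col: "?s (i, j) < ?s (i', j)" if "(i, j) \<in> ?Y" "(i', j) \<in> ?Y" "i < i'" for i i' j
    using tableau_column[OF that] that standardization_less_iff[OF that(1,2)]
    by (auto simp: standard_less_def)
  have "?s \<in> ?Y \<rightarrow>\<^sub>E UNIV" by (simp add: standardization_def)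
  then show ?thesis unfolding standard_tableaux_def using bij row col by blast
qed

text \<open>For equal integers \<open>standard_less\<close> is itself the non-descent. For equal odd
  letters it compares rows only; if the column grew as well, the corner
  \<open>(fst n, snd m)\<close> would hold an entry larger than \<open>T n\<close> and at most
  \<open>T m\<close>.\<close>

lemma standardization_compatible:
  "compatible_word (\<lambda>k. Suc k \<in> descent_set lam (standardization (young_diagram lam) T))
    (map T (standard_nodes lam (standardization (young_diagram lam) T)))"
proof -
  let ?Y = "young_diagram lam"
  define S where "S = standardization (young_diagram lam) T"
  have S: "S \<in> standard_tableaux lam" unfolding S_def by (rule standardization_standard)
  have "T n \<le> T m \<and> (T n = T m \<longrightarrow> (Suc k \<in> descent_set lam S \<longleftrightarrow> \<not> integral (T n)))"
    if k: "Suc k < sum_list lam" and n: "n = standard_nodes lam S ! k"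
      and m: "m = standard_nodes lam S ! Suc k" for k n m
  proof -
    have Y: "n \<in> ?Y" "m \<in> ?Y" and "S n < S m"
      using standard_nodes_nth[OF S] k n m by auto
    then have less: "standard_less T n m" using standardization_less_iff S_def by simp
    have "snd m \<le> snd n" if eq: "T n = T m" and odd: "\<not> integral (T n)"
    proof (rule ccontr)
      assume lt: "\<not> snd m \<le> snd n"
      have "fst n < fst m" using less that by (simp add: standard_less_def)
      moreover have "(fst n, snd m) \<in> ?Y"
        using young_diagram_closed[OF lam, of "fst m" "snd m"] Y(2) calculation by simp
      ultimately have "T n < T (fst n, snd m)" "T (fst n, snd m) \<le> T m"
        using tableau_row[of "fst n" "snd n" "snd m"] Y lt odd
          tableau_column[of "fst n" "snd m" "fst m"] by auto
      then show False using eq by simp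
    qed
    then show ?thesis
      using less mem_descent_set_iff[OF S k] n m by (auto simp: standard_less_def split: if_splits)
  qed
  then show ?thesis by (simp add: compatible_word_def S_def)
qed

end

end

section \<open>Ribbon diagrams\<close>

definition descents_upto :: "nat set \<Rightarrow> nat \<Rightarrow> nat" where
  "descents_upto X k = card {s \<in> X. s \<le> k}"

text \<open>The nodes of the ribbon of \<open>composition_of_set r X\<close> from top left to bottom right: each
  node is below its predecessor if its index lies in \<open>X\<close>, and to the right of it otherwise.
  Node \<open>k\<close> thus lies on the antidiagonal \<open>i + j = k\<close>.\<close>

definition ribbon_node :: "nat set \<Rightarrow> nat \<Rightarrow> node" where
  "ribbon_node X k = (descents_upto X k, k - descents_upto X k)"

text \<open>Used to turn comparisons with the partial sums of a composition, which are the elements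
  of the descent set, into comparisons with \<open>descents_upto\<close>.\<close>

lemma nth_le_iff_less_card:
  fixes xs :: "nat list"
  assumes xs: "sorted xs" "distinct xs" and i: "i < length xs"
  shows "xs ! i \<le> k \<longleftrightarrow> i < card {s \<in> set xs. s \<le> k}"
proof
  have inj: "inj_on ((!) xs) {..<n}" if "n \<le> length xs" for n
    using that xs(2) by (intro inj_on_nth) auto
  show "i < card {s \<in> set xs. s \<le> k}" if "xs ! i \<le> k"
  proof -
    have "(!) xs ` {..<Suc i} \<subseteq> {s \<in> set xs. s \<le> k}"
      using that i sorted_nth_mono[OF xs(1) _ i] by (force simp: less_Suc_eq_le)
    then have "card ((!) xs ` {..<Suc i}) \<le> card {s \<in> set xs. s \<le> k}" by (intro card_mono) auto
    then show ?thesis using card_image[OF inj, of "Suc i"] i by simp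
  qed
  show "xs ! i \<le> k" if less: "i < card {s \<in> set xs. s \<le> k}"
  proof (rule ccontr)
    assume gt: "\<not> xs ! i \<le> k"
    have "{s \<in> set xs. s \<le> k} \<subseteq> (!) xs ` {..<i}"
    proof
      fix s assume s: "s \<in> {s \<in> set xs. s \<le> k}"
      then obtain l where l: "l < length xs" "s = xs ! l" by (auto simp: in_set_conv_nth)
      then have "l < i"
        using sorted_nth_mono[OF xs(1), of i l] s gt by (cases "l < i") auto
      then show "s \<in> (!) xs ` {..<i}" using l by auto
    qed
    then have "card {s \<in> set xs. s \<le> k} \<le> card ((!) xs ` {..<i})" by (intro card_mono) auto
    also have "\<dots> \<le> i" using card_image_le[of "{..<i}" "(!) xs"] by simp
    finally show False using less by simp
  qed
qed

context
  fixes r :: nat and X :: "nat set"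
  assumes X: "X \<subseteq> {1..<r}"
begin

lemma finite_descents: "finite X"
  using X finite_subset by blast

lemma descents_upto_Suc:
  "descents_upto X (Suc k) = descents_upto X k + (if Suc k \<in> X then 1 else 0)"
proof -
  have "{s \<in> X. s \<le> Suc k} =
    (if Suc k \<in> X then insert (Suc k) {s \<in> X. s \<le> k} else {s \<in> X. s \<le> k})"
    by (auto simp: le_Suc_eq)
  then show ?thesis using finite_descents by (simp add: descents_upto_def)
qed

lemma descents_upto_0: "descents_upto X 0 = 0"
  using X by (auto simp: descents_upto_def card_eq_0_iff)

lemma descents_upto_mono: "k \<le> l \<Longrightarrow> descents_upto X k \<le> descents_upto X l"
  by (rule lift_Suc_mono_le[of "descents_upto X"]) (simp_all add: descents_upto_Suc)

lemma descents_upto_le_add: "descents_upto X (k + d) \<le> descents_upto X k + d"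
  by (induction d) (auto simp: descents_upto_Suc)

lemma descents_upto_le: "descents_upto X k \<le> k"
  using descents_upto_le_add[of 0 k] by (simp add: descents_upto_0)

text \<open>A ribbon meets each antidiagonal \<open>i + j = k\<close> with \<open>k < r\<close> in
  one node, whose row is the number of descents up to \<open>k\<close>. This replaces the row
  lengths of the composition by the descent set.\<close>

lemma mem_ribbon_diagram_iff:
  "(i, j) \<in> ribbon_diagram (composition_of_set r X) \<longleftrightarrow> i + j < r \<and> descents_upto X (i + j) = i"
proof (cases "r = 0")
  case True
  then show ?thesis by (simp add: ribbon_diagram_def composition_of_set_def)
next
  case False
  define xs where "xs = sorted_list_of_set X"
  \<comment> \<open>The partial sums of the composition, from 0 to \<open>r\<close>: row
    \<open>l\<close> holds the nodes numbered from \<open>b ! l\<close> to just below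
    \<open>b ! Suc l\<close>.\<close>
  define b where "b = 0 # xs @ [r]"
  define \<alpha> where "\<alpha> = composition_of_set r X"
  have set: "set xs = X" and sorted: "sorted xs" "distinct xs"
    using finite_descents by (simp_all add: xs_def)
  have len: "length \<alpha> = Suc (length xs)"
    using False by (simp add: \<alpha>_def composition_of_set_def xs_def Let_def)
  have nth: "\<alpha> ! l = b ! Suc l - b ! l" if "l \<le> length xs" for l
    using that False
    by (auto simp: \<alpha>_def composition_of_set_def xs_def[symmetric] Let_def b_def nth_append nth_Cons'
        less_Suc_eq_le)
  have sorted_b: "sorted_wrt (<) b"
    using sorted X set False by (auto simp: b_def sorted_wrt_append strict_sorted_iff)
  have less: "b ! l < b ! Suc l" if "l \<le> length xs" for l
    by (rule sorted_wrt_nth_less[OF sorted_b]) (use that in \<open>simp_all add: b_def\<close>)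
  \<comment> \<open>Consecutive rows share a column, so \<open>ribbon_start\<close> loses one for
    each row passed; adding \<open>l\<close> restores the partial sum. Strict growth of
    \<open>b\<close> keeps the truncated subtractions exact.\<close>
  have start: "ribbon_start \<alpha> l + l = b ! l" if "l \<le> length xs" for l
    using that
  proof (induction l)
    case 0
    then show ?case by (simp add: ribbon_start_def b_def)
  next
    case (Suc l)
    then show ?case using less[of l] nth[of l] by (simp add: ribbon_start_def)
  qed
  have bnd: "b ! Suc l \<le> r" if "l \<le> length xs" for l
  proof (cases "l < length xs")
    case True
    then have "xs ! l \<in> X" using set by auto
    then show ?thesis using X True by (auto simp: b_def nth_append)
  qed (use that in \<open>simp add: b_def\<close>)
  have card: "descents_upto X k \<le> length xs" for k
  proof -
    have "descents_upto X k \<le> card X"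
      using finite_descents by (auto simp: descents_upto_def intro: card_mono)
    then show ?thesis using set distinct_card[OF sorted(2)] by simp
  qed
  have row: "b ! l \<le> k \<and> k < b ! Suc l \<longleftrightarrow> k < r \<and> descents_upto X k = l"
    if l: "l \<le> length xs" for l k
  proof -
    have "b ! l \<le> k \<longleftrightarrow> l \<le> descents_upto X k"
    proof (cases l)
      case (Suc m)
      then show ?thesis
        using nth_le_iff_less_card[OF sorted, of m k] l
        by (simp add: b_def nth_append set descents_upto_def Suc_le_eq)
    qed (simp add: b_def)
    moreover have "k < b ! Suc l \<longleftrightarrow> k < r \<and> descents_upto X k \<le> l"
    proof (cases "l = length xs")
      case True
      then show ?thesis using card[of k] by (simp add: b_def)
    next
      case False
      then show ?thesis
        using nth_le_iff_less_card[OF sorted, of l k] l bnd[OF l]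
        by (auto simp: b_def nth_append set descents_upto_def not_less[symmetric])
    qed
    ultimately show ?thesis by auto
  qed
  have "(i, j) \<in> ribbon_diagram \<alpha> \<longleftrightarrow> i \<le> length xs \<and> b ! i \<le> i + j \<and> i + j < b ! Suc i"
    using start[of i] nth[of i] less[of i] by (auto simp: ribbon_diagram_def len less_Suc_eq_le)
  also have "\<dots> \<longleftrightarrow> i + j < r \<and> descents_upto X (i + j) = i"
    using row[of i "i + j"] card[of "i + j"] by auto
  finally show ?thesis by (simp add: \<alpha>_def)
qed

lemma ribbon_node_mem: "k < r \<Longrightarrow> ribbon_node X k \<in> ribbon_diagram (composition_of_set r X)"
  using descents_upto_le[of k] by (simp add: ribbon_node_def mem_ribbon_diagram_iff)

lemma ribbon_node_antidiagonal: "fst (ribbon_node X k) + snd (ribbon_node X k) = k"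
  using descents_upto_le[of k] by (simp add: ribbon_node_def)

lemma ribbon_node_inverse:
  "(i, j) \<in> ribbon_diagram (composition_of_set r X) \<Longrightarrow> ribbon_node X (i + j) = (i, j)"
  by (simp add: ribbon_node_def mem_ribbon_diagram_iff)

lemma set_ribbon_nodes:
  "set (map (ribbon_node X) [0..<r]) = ribbon_diagram (composition_of_set r X)"
proof (intro equalityI subsetI)
  fix n assume n: "n \<in> ribbon_diagram (composition_of_set r X)"
  obtain i j where ij: "n = (i, j)" by force
  then have "n = ribbon_node X (i + j)" "i + j < r"
    using n ribbon_node_inverse[of i j] mem_ribbon_diagram_iff[of i j] by auto
  then show "n \<in> set (map (ribbon_node X) [0..<r])" by auto
qed (auto simp: ribbon_node_mem)

lemma ribbon_tableau_iff:
  assumes Q: "Q \<in> ribbon_diagram (composition_of_set r X) \<rightarrow>\<^sub>E UNIV"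
  shows "Q \<in> tableaux (ribbon_diagram (composition_of_set r X)) \<longleftrightarrow>
    compatible_word (\<lambda>k. Suc k \<in> X) (map Q (map (ribbon_node X) [0..<r]))"
    (is "Q \<in> tableaux ?R \<longleftrightarrow> compatible_word ?D ?a")
proof
  have nth: "?a ! k = Q (ribbon_node X k)" if "k < r" for k
    using that by simp
  assume T: "Q \<in> tableaux ?R"
  have row: "Q (i, j) \<le> Q (i, j') \<and> (\<not> integral (Q (i, j)) \<longrightarrow> Q (i, j) < Q (i, j'))"
    if "(i, j) \<in> ?R" "(i, j') \<in> ?R" "j < j'" for i j j'
    using T that unfolding tableaux_def by blast
  have col: "Q (i, j) \<le> Q (i', j) \<and> (integral (Q (i, j)) \<longrightarrow> Q (i, j) < Q (i', j))"
    if "(i, j) \<in> ?R" "(i', j) \<in> ?R" "i < i'" for i i' j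
    using T that unfolding tableaux_def by blast
  show "compatible_word ?D ?a"
    unfolding compatible_word_def
  proof (intro allI impI)
    fix k assume "Suc k < length ?a"
    then have k: "Suc k < r" by simp
    have mem: "ribbon_node X k \<in> ?R" "ribbon_node X (Suc k) \<in> ?R"
      using ribbon_node_mem[of k] ribbon_node_mem[of "Suc k"] k by auto
    show "?a ! k \<le> ?a ! Suc k \<and> (?a ! k = ?a ! Suc k \<longrightarrow> (Suc k \<in> X \<longleftrightarrow> \<not> integral (?a ! k)))"
    proof (cases "Suc k \<in> X")
      case True
      then show ?thesis
        using nth[of k] nth[of "Suc k"] k
          mem col[of "descents_upto X k" "k - descents_upto X k" "Suc (descents_upto X k)"]
        by (auto simp: ribbon_node_def descents_upto_Suc)
    next
      case False
      then show ?thesis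
        using nth[of k] nth[of "Suc k"] k mem descents_upto_le[of k]
          row[of "descents_upto X k" "k - descents_upto X k" "Suc k - descents_upto X k"]
        by (auto simp: ribbon_node_def descents_upto_Suc)
    qed
  qed
next
  assume D: "compatible_word ?D ?a"
  have nth: "Q (i, j) = ?a ! (i + j)" "i + j < r" "descents_upto X (i + j) = i"
    if "(i, j) \<in> ?R" for i j
    using that ribbon_node_inverse[OF that] by (simp_all add: mem_ribbon_diagram_iff)
  have chain: "?a ! k \<le> ?a ! l \<and> (?a ! k = ?a ! l \<longrightarrow> (Suc k \<in> X \<longleftrightarrow> \<not> integral (?a ! k)))"
    if "k < l" "l < r" for k l
    using compatible_word_sorted[OF D, of k l] compatible_word_block(2)[OF D, of k k l] that by auto
  have row: "Q (i, j) \<le> Q (i, j') \<and> (\<not> integral (Q (i, j)) \<longrightarrow> Q (i, j) < Q (i, j'))"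
    if "(i, j) \<in> ?R" "(i, j') \<in> ?R" "j < j'" for i j j'
  proof -
    note n = nth[OF that(1)] and m = nth[OF that(2)]
    \<comment> \<open>The row is still \<open>i\<close> at \<open>i + j'\<close>, so it cannot have
      risen in the step after \<open>i + j\<close>, which is therefore no descent.\<close>
    have "descents_upto X (Suc (i + j)) \<le> i"
      using descents_upto_mono[of "Suc (i + j)" "i + j'"] that m(3) by simp
    then have "Suc (i + j) \<notin> X" using n(3) by (auto simp: descents_upto_Suc)
    then show ?thesis using chain[of "i + j" "i + j'"] that(3) n(1,2) m(1,2)
      by (auto simp: order_less_le)
  qed
  have col: "Q (i, j) \<le> Q (i', j) \<and> (integral (Q (i, j)) \<longrightarrow> Q (i, j) < Q (i', j))"
    if "(i, j) \<in> ?R" "(i', j) \<in> ?R" "i < i'" for i i' j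
  proof -
    note n = nth[OF that(1)] and m = nth[OF that(2)]
    \<comment> \<open>From \<open>i + j\<close> to \<open>i' + j\<close> the row rises by the number
      of steps, and each step raises it by at most one; so the very first step is a descent.\<close>
    have "Suc (i + j) + (i' - Suc i) = i' + j" using that(3) by simp
    then have "i' \<le> descents_upto X (Suc (i + j)) + (i' - Suc i)"
      using descents_upto_le_add[of "Suc (i + j)" "i' - Suc i"] m(3) by metis
    then have "Suc (i + j) \<in> X" using n(3) that(3) by (auto simp: descents_upto_Suc split: if_splits)
    then show ?thesis using chain[of "i + j" "i' + j"] that(3) n(1,2) m(1,2)
      by (auto simp: order_less_le)
  qed
  show "Q \<in> tableaux ?R" unfolding tableaux_def using Q row col by blast
qed

lemma ribbon_reading_descents:
  "reading_descents (map (ribbon_node X) [0..<r]) (ribbon_reading (composition_of_set r X))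
    (\<lambda>k. Suc k \<in> X)"
proof -
  let ?\<alpha> = "composition_of_set r X"
  let ?less = "\<lambda>a b :: node. fst a < fst b \<or> fst a = fst b \<and> snd b < snd a"
  let ?row = "\<lambda>i. map (Pair i) (rev [ribbon_start ?\<alpha> i ..< ribbon_start ?\<alpha> i + ?\<alpha> ! i])"
  have row: "sorted_wrt ?less (?row i)" for i
    by (simp add: sorted_wrt_map sorted_wrt_rev)
  have "sorted_wrt ?less (concat (map ?row [0..<n]))" for n
    by (induction n) (use row in \<open>auto simp: sorted_wrt_append\<close>)
  then have sorted: "sorted_wrt ?less (ribbon_reading ?\<alpha>)" by (simp add: ribbon_reading_def)
  have dist: "distinct (ribbon_reading ?\<alpha>)"
    using sorted by (auto simp: distinct_conv_nth sorted_wrt_iff_nth_less)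
      (metis less_irrefl linorder_neqE_nat)
  have set: "set (ribbon_reading ?\<alpha>) = ribbon_diagram ?\<alpha>"
    by (auto simp: ribbon_reading_def ribbon_diagram_def)
  have before: "p < q"
    if "p < length (ribbon_reading ?\<alpha>)" "?less (ribbon_reading ?\<alpha> ! p) (ribbon_reading ?\<alpha> ! q)"
    for p q
  proof (rule ccontr)
    assume "\<not> p < q"
    then have "p = q \<or> ?less (ribbon_reading ?\<alpha> ! q) (ribbon_reading ?\<alpha> ! p)"
      using sorted_wrt_nth_less[OF sorted, of q p] that(1) by linarith
    then show False using that(2) by auto
  qed
  have "Suc k \<in> X \<longleftrightarrow> p < q"
    if "p < length (ribbon_reading ?\<alpha>)" "q < length (ribbon_reading ?\<alpha>)"
      "ribbon_reading ?\<alpha> ! p = ribbon_node X k" "ribbon_reading ?\<alpha> ! q = ribbon_node X (Suc k)"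
    for k p q
    using before[of p q] before[of q p] that descents_upto_le[of k]
    by (cases "Suc k \<in> X") (auto simp: ribbon_node_def descents_upto_Suc Suc_diff_le)
  moreover have "distinct (map (ribbon_node X) [0..<r])"
    by (auto simp: distinct_map intro!: inj_on_inverseI[where g = "\<lambda>n. fst n + snd n"]
        ribbon_node_antidiagonal)
  ultimately show ?thesis
    using dist set set_ribbon_nodes by (auto simp: reading_descents_def simp del: set_map)
qed

end

section \<open>Tableau crystals\<close>

text \<open>The common interface of a Young diagram with a fixed standard tableau and of a ribbon.
  Tableau-hood is required only as a consequence of compatibility: a tableau on a Young diagram is
  compatible with a single standard tableau, its standardization.\<close>

definition descent_chart :: "node set \<Rightarrow> node list \<Rightarrow> node list \<Rightarrow> (nat \<Rightarrow> bool) \<Rightarrow> bool" where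
  "descent_chart R reading ns D \<longleftrightarrow> set reading = R \<and> reading_descents ns reading D \<and>
    (\<forall>T\<in>R \<rightarrow>\<^sub>E UNIV. compatible_word D (map T ns) \<longrightarrow> T \<in> tableaux R)"

lemma tableaux_extensional: "T \<in> tableaux R \<Longrightarrow> T \<in> R \<rightarrow>\<^sub>E UNIV"
  unfolding tableaux_def by blast

lemma inj_on_reading:
  assumes "set reading = R"
  shows "inj_on (\<lambda>T. map T reading) (tableaux R)"
proof (rule inj_onI)
  fix T T' assume T: "T \<in> tableaux R" "T' \<in> tableaux R" and "map T reading = map T' reading"
  then have "T x = T' x" if "x \<in> R" for x using assms that by auto
  then show "T = T'" using T[THEN tableaux_extensional] by (metis PiE_ext)
qed

context
  fixes R reading ns D T
  assumes chart: "descent_chart R reading ns D"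
    and T: "T \<in> tableaux R" and D: "compatible_word D (map T ns)"
begin

lemma chart_nodes: "set reading = R" "set ns = R" "distinct ns" "distinct reading"
  using chart by (auto simp: descent_chart_def reading_descents_def)

lemma act_on_word_chart:
  "act_on_word g i (map T reading) =
    map_option (\<lambda>(k, b). map (T(ns ! k := b)) reading) (sequence_action g D i (map T ns))"
  using act_on_word_reading[OF _ D] chart by (simp add: descent_chart_def)

text \<open>The same \<open>D\<close> serves before and after the action; this is why the operators
  never leave a summand.\<close>

lemma sequence_action_tableau:
  assumes act: "sequence_action g D i (map T ns) = Some (k, b)" and g: "g = letter_e \<or> g = letter_f"
  shows "k < length ns" "T(ns ! k := b) \<in> tableaux R"
    "map (T(ns ! k := b)) ns = (map T ns)[k := b]" "compatible_word D (map (T(ns ! k := b)) ns)"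
proof -
  show k: "k < length ns" using sequence_action_compatible[OF D act g] by simp
  have "ns ! l = ns ! k \<longleftrightarrow> l = k" if "l < length ns" for l
    using that k nth_eq_iff_index_eq[OF chart_nodes(3)] by simp
  then show upd: "map (T(ns ! k := b)) ns = (map T ns)[k := b]"
    using k by (intro nth_equalityI) (auto simp: nth_list_update)
  then show comp: "compatible_word D (map (T(ns ! k := b)) ns)"
    using sequence_action_compatible[OF D act g] by simp
  have "T(ns ! k := b) \<in> R \<rightarrow>\<^sub>E UNIV"
    using tableaux_extensional[OF T] k chart_nodes(2) nth_mem[of k ns]
    by (auto simp: PiE_def extensional_def)
  then show "T(ns ! k := b) \<in> tableaux R"
    using chart comp by (simp add: descent_chart_def)
qed

lemma f_op_chart:
  "f_op (tableau_crystal R reading) i T =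
    map_option (\<lambda>(k, b). T(ns ! k := b)) (sequence_action letter_f D i (map T ns))"
proof (cases "sequence_action letter_f D i (map T ns)")
  case None
  then show ?thesis
    by (simp add: tableau_crystal_def pullback_crystal_def word_crystal_def act_on_word_chart)
next
  case (Some p)
  obtain k b where p: "p = (k, b)" by force
  have "inv_into (tableaux R) (\<lambda>T. map T reading) (map (T(ns ! k := b)) reading) = T(ns ! k := b)"
    using inv_into_f_f[OF inj_on_reading[OF chart_nodes(1)] sequence_action_tableau(2)] Some p
    by blast
  then show ?thesis using Some p
    by (simp add: tableau_crystal_def pullback_crystal_def word_crystal_def act_on_word_chart
        del: map_eq_conv)
qed

lemma eps_chart:
  "eps (tableau_crystal R reading) i T =
    (if sequence_action letter_e D i (map T ns) \<noteq> None then 1 else 0)"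
  by (simp add: tableau_crystal_def pullback_crystal_def word_crystal_def act_on_word_chart)

lemma phi_chart:
  "phi (tableau_crystal R reading) i T =
    (if sequence_action letter_f D i (map T ns) \<noteq> None then 1 else 0)"
  by (simp add: tableau_crystal_def pullback_crystal_def word_crystal_def act_on_word_chart)

lemma wt_chart: "wt (tableau_crystal R reading) T = (\<Sum>b\<leftarrow>map T ns. eps_vec b)"
  using chart_nodes
  by (simp add: tableau_crystal_def pullback_crystal_def word_crystal_def comp_def
      sum_list_distinct_conv_sum_set)

lemma act_on_word_stable:
  assumes "act_on_word g i (map T reading) = Some w" "g = letter_e \<or> g = letter_f"
  shows "w \<in> (\<lambda>T. map T reading) ` tableaux R"
  using assms(1) sequence_action_tableau(2)[OF _ assms(2)] by (auto simp: act_on_word_chart)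

end

text \<open>Stability is checked one tableau at a time, so the chart may vary with \<open>T\<close>:
  a Young diagram has one for each standard tableau.\<close>

lemma is_crystal_tableau_crystal:
  assumes set: "set reading = R"
    and "\<And>T. T \<in> tableaux R \<Longrightarrow> \<exists>ns D. descent_chart R reading ns D \<and> compatible_word D (map T ns)"
  shows "is_crystal (tableau_crystal R reading)"
  unfolding tableau_crystal_def
proof (rule is_crystal_pullback[OF is_crystal_word_crystal inj_on_reading[OF set]])
  show "w \<in> (\<lambda>T. map T reading) ` tableaux R"
    if "T \<in> tableaux R" "e_op word_crystal i (map T reading) = Some w" for i T w
    using assms(2)[OF that(1)] that act_on_word_stable[OF _ that(1), of reading _ _ letter_e i w]
    by (auto simp: word_crystal_def)
  show "w \<in> (\<lambda>T. map T reading) ` tableaux R"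
    if "T \<in> tableaux R" "f_op word_crystal i (map T reading) = Some w" for i T w
    using assms(2)[OF that(1)] that act_on_word_stable[OF _ that(1), of reading _ _ letter_f i w]
    by (auto simp: word_crystal_def)
qed (simp add: word_crystal_def)

section \<open>Ribbons of descent compositions and the transfer of fillings to them\<close>

lemma descent_set_subset: "descent_set lam S \<subseteq> {1..<sum_list lam}"
  by (auto simp: descent_set_def)

abbreviation descent_ribbon :: "nat list \<Rightarrow> (node \<Rightarrow> nat) \<Rightarrow> node set" where
  "descent_ribbon lam S \<equiv> ribbon_diagram (descent_composition lam S)"

definition ribbon_nodes :: "nat list \<Rightarrow> (node \<Rightarrow> nat) \<Rightarrow> node list" where
  "ribbon_nodes lam S = map (ribbon_node (descent_set lam S)) [0..<sum_list lam]"

lemma ribbon_chart: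
  "descent_chart (descent_ribbon lam S) (ribbon_reading (descent_composition lam S))
    (ribbon_nodes lam S) (\<lambda>k. Suc k \<in> descent_set lam S)"
proof -
  note X = descent_set_subset[of lam S]
  have "set (ribbon_reading (descent_composition lam S)) = descent_ribbon lam S"
    by (auto simp: ribbon_reading_def ribbon_diagram_def)
  then show ?thesis
    using ribbon_reading_descents[OF X] ribbon_tableau_iff[OF X]
    by (simp add: descent_chart_def ribbon_nodes_def descent_composition_def)
qed

lemma ribbon_compatible:
  "Q \<in> tableaux (descent_ribbon lam S) \<Longrightarrow>
    compatible_word (\<lambda>k. Suc k \<in> descent_set lam S) (map Q (ribbon_nodes lam S))"
  using ribbon_tableau_iff[OF descent_set_subset[of lam S], of Q]
    tableaux_extensional[of Q "descent_ribbon lam S"]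
  by (simp add: ribbon_nodes_def descent_composition_def)

lemma is_crystal_ribbon_crystal: "is_crystal (ribbon_crystal (descent_composition lam S))"
  unfolding ribbon_crystal_def
proof (rule is_crystal_tableau_crystal)
  show "set (ribbon_reading (descent_composition lam S)) = descent_ribbon lam S"
    using ribbon_chart[of lam S] by (simp add: descent_chart_def)
qed (use ribbon_chart ribbon_compatible in blast)

text \<open>The antidiagonal \<open>fst x + snd x\<close> is the position of \<open>x\<close> among
  the ribbon nodes, so entries are copied from the node of \<open>S\<close> at the same
  position.\<close>

definition ribbon_filling :: "nat list \<Rightarrow> (node \<Rightarrow> nat) \<Rightarrow> (node \<Rightarrow> halfint) \<Rightarrow> node \<Rightarrow> halfint" where
  "ribbon_filling lam S T =
    (\<lambda>x\<in>descent_ribbon lam S. T (standard_nodes lam S ! (fst x + snd x)))"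

lemma map_ribbon_filling:
  "map (ribbon_filling lam S T) (ribbon_nodes lam S) = map T (standard_nodes lam S)"
proof (rule nth_equalityI)
  note X = descent_set_subset[of lam S]
  fix k assume "k < length (map (ribbon_filling lam S T) (ribbon_nodes lam S))"
  then have k: "k < sum_list lam" by (simp add: ribbon_nodes_def)
  show "map (ribbon_filling lam S T) (ribbon_nodes lam S) ! k = map T (standard_nodes lam S) ! k"
    using k ribbon_node_mem[OF X k] ribbon_node_antidiagonal[OF X, of k]
    by (simp add: ribbon_nodes_def ribbon_filling_def descent_composition_def)
qed (simp add: ribbon_nodes_def)

lemma ribbon_filling_tableau:
  assumes "compatible_word (\<lambda>k. Suc k \<in> descent_set lam S) (map T (standard_nodes lam S))"
  shows "ribbon_filling lam S T \<in> tableaux (descent_ribbon lam S)"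
  using ribbon_chart[of lam S] assms
  by (auto simp: descent_chart_def map_ribbon_filling[symmetric] ribbon_filling_def
      simp del: map_eq_conv)

lemma ribbon_filling_eqI:
  assumes "Q \<in> descent_ribbon lam S \<rightarrow>\<^sub>E UNIV"
    and "map Q (ribbon_nodes lam S) = map T (standard_nodes lam S)"
  shows "ribbon_filling lam S T = Q"
proof (rule PiE_ext[of _ "descent_ribbon lam S" "\<lambda>_. UNIV"])
  show "ribbon_filling lam S T x = Q x" if "x \<in> descent_ribbon lam S" for x
  proof -
    have "x \<in> set (ribbon_nodes lam S)"
      using ribbon_chart[of lam S] that by (simp add: descent_chart_def reading_descents_def)
    then show ?thesis
      using assms(2)[folded map_ribbon_filling[of lam S T]] by auto
  qed
qed (use assms(1) in \<open>auto simp: ribbon_filling_def\<close>)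

theorem proposition4p5:
  fixes lam :: "nat list" and reading :: "(nat \<times> nat) list"
  assumes "is_partition lam"
    and "admissible_reading (young_diagram lam) reading"
  shows "young_crystal lam reading \<simeq>\<^sub>c
    crystal_sum (standard_tableaux lam) (\<lambda>T. ribbon_crystal (descent_composition lam T))"
proof -
  let ?Y = "young_diagram lam"
  let ?D = "\<lambda>S k. Suc k \<in> descent_set lam S"
  let ?C = "crystal_sum (standard_tableaux lam) (\<lambda>T. ribbon_crystal (descent_composition lam T))"
  have young: "young_crystal lam reading = tableau_crystal ?Y reading"
    by (simp add: young_crystal_def)
  have elems_Y: "elems (young_crystal lam reading) = tableaux ?Y"
    by (simp add: young tableau_crystal_def pullback_crystal_def)
  have elems_C: "elems ?C = Sigma (standard_tableaux lam) (\<lambda>S. tableaux (descent_ribbon lam S))"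
    by (simp add: crystal_sum_def ribbon_crystal_def tableau_crystal_def pullback_crystal_def)
  have set: "set reading = ?Y" using assms(2) by (simp add: admissible_reading_def)
  have chart: "descent_chart ?Y reading (standard_nodes lam S) (?D S)"
    if "S \<in> standard_tableaux lam" for S
    using standard_reading_descents[OF that assms] compatible_imp_tableau[OF assms(1) that] set
    by (simp add: descent_chart_def)
  define std where "std T = standardization ?Y T" for T
  define h where "h T = (std T, ribbon_filling lam (std T) T)" for T
  have std: "std T \<in> standard_tableaux lam"
    and comp: "compatible_word (?D (std T)) (map T (standard_nodes lam (std T)))"
    if "T \<in> tableaux ?Y" for T
    using standardization_standard[OF assms(1) that] standardization_compatible[OF assms(1) that]
    by (simp_all add: std_def)
  have std_eq: "std T = S" if "S \<in> standard_tableaux lam"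
    "compatible_word (?D S) (map T (standard_nodes lam S))" for S T
    using compatible_imp_standardization[OF assms(1) that] by (simp add: std_def)
  have crystal_Y: "is_crystal (young_crystal lam reading)"
    unfolding young using is_crystal_tableau_crystal[OF set] std comp chart by blast
  have crystal_C: "is_crystal ?C"
    by (rule is_crystal_sum) (rule is_crystal_ribbon_crystal)
  have inj: "inj_on h (tableaux ?Y)"
  proof (rule inj_onI)
    fix T T' assume T: "T \<in> tableaux ?Y" "T' \<in> tableaux ?Y" and eq: "h T = h T'"
    then have "map T (standard_nodes lam (std T)) = map T' (standard_nodes lam (std T))"
      by (metis Pair_inject h_def map_ribbon_filling)
    then have "T x = T' x" if "x \<in> ?Y" for x
      using that set_standard_nodes[OF std[OF T(1)]] by auto
    then show "T = T'" using T[THEN tableaux_extensional] by (metis PiE_ext)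
  qed
  have "\<exists>T\<in>tableaux ?Y. h T = (S, Q)"
    if S: "S \<in> standard_tableaux lam" and Q: "Q \<in> tableaux (descent_ribbon lam S)" for S Q
  proof -
    \<comment> \<open>The label \<open>S n\<close> stands at position \<open>S n - 1\<close> of
      \<open>standard_nodes\<close>, so this copies the entries of \<open>Q\<close> back along the
      two lists of nodes.\<close>
    define T where "T = (\<lambda>n\<in>?Y. Q (ribbon_nodes lam S ! (S n - 1)))"
    have T: "map T (standard_nodes lam S) = map Q (ribbon_nodes lam S)"
      using standard_nodes_nth[OF S]
      by (intro nth_equalityI) (auto simp: T_def ribbon_nodes_def)
    have D: "compatible_word (?D S) (map T (standard_nodes lam S))"
      unfolding T by (rule ribbon_compatible[OF Q])
    have "T \<in> tableaux ?Y"
      by (rule compatible_imp_tableau[OF assms(1) S _ D]) (simp add: T_def)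
    moreover have "ribbon_filling lam S T = Q"
      by (rule ribbon_filling_eqI[OF tableaux_extensional[OF Q] T[symmetric]])
    ultimately show ?thesis using std_eq[OF S D] by (auto simp: h_def)
  qed
  moreover have "h T \<in> elems ?C" if "T \<in> tableaux ?Y" for T
    using std[OF that] ribbon_filling_tableau[OF comp[OF that]] by (simp add: elems_C h_def)
  ultimately have bij: "bij_betw h (elems (young_crystal lam reading)) (elems ?C)"
    using inj unfolding bij_betw_def elems_Y by (force simp: elems_C)
  have "crystal_isomorphism (young_crystal lam reading) ?C h"
  proof (rule crystal_isomorphismI[OF crystal_Y crystal_C bij], unfold elems_Y)
    fix i T assume T: "T \<in> tableaux ?Y"
    define S where "S = std T"
    define Q where "Q = ribbon_filling lam S T"
    have S: "S \<in> standard_tableaux lam" and D: "compatible_word (?D S) (map T (standard_nodes lam S))"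
      using std comp T by (simp_all add: S_def)
    have Q: "Q \<in> tableaux (descent_ribbon lam S)"
      unfolding Q_def by (rule ribbon_filling_tableau[OF D])
    have h: "h T = (S, Q)" by (simp add: h_def S_def Q_def)
    have map_Q: "map Q (ribbon_nodes lam S) = map T (standard_nodes lam S)"
      unfolding Q_def by (rule map_ribbon_filling)
    have DQ: "compatible_word (?D S) (map Q (ribbon_nodes lam S))" using D map_Q by metis
    note cT = chart[OF S] T D and cQ = ribbon_chart[of lam S] Q DQ
    show "wt ?C (h T) = wt (young_crystal lam reading) T"
      using wt_chart[OF cT] wt_chart[OF cQ]
      by (simp only: h map_Q young) (simp add: crystal_sum_def ribbon_crystal_def)
    show "eps ?C i (h T) = eps (young_crystal lam reading) i T"
      using eps_chart[OF cT] eps_chart[OF cQ]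
      by (simp only: h map_Q young) (simp add: crystal_sum_def ribbon_crystal_def)
    show "phi ?C i (h T) = phi (young_crystal lam reading) i T"
      using phi_chart[OF cT] phi_chart[OF cQ]
      by (simp only: h map_Q young) (simp add: crystal_sum_def ribbon_crystal_def)
    let ?act = "sequence_action letter_f (?D S) i (map T (standard_nodes lam S))"
    \<comment> \<open>The changed word is still compatible with \<open>S\<close>, so the
      standardization stays \<open>S\<close>. Both fillings change at the same position by the same
      letter and hence keep a common word of entries.\<close>
    have upd: "h (T(standard_nodes lam S ! k := b)) = (S, Q(ribbon_nodes lam S ! k := b))"
      if "?act = Some (k, b)" for k b
    proof -
      let ?T = "T(standard_nodes lam S ! k := b)" and ?Q = "Q(ribbon_nodes lam S ! k := b)"
      have act_Q: "sequence_action letter_f (?D S) i (map Q (ribbon_nodes lam S)) = Some (k, b)"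
        using that by (simp only: map_Q)
      have "std ?T = S"
        using std_eq[OF S sequence_action_tableau(4)[OF cT that]] by simp
      moreover have "map ?Q (ribbon_nodes lam S) = map ?T (standard_nodes lam S)"
        using sequence_action_tableau(3)[OF cT that] sequence_action_tableau(3)[OF cQ act_Q] map_Q
        by simp
      then have "ribbon_filling lam S ?T = ?Q"
        using tableaux_extensional[OF sequence_action_tableau(2)[OF cQ act_Q]]
        by (intro ribbon_filling_eqI) auto
      ultimately show ?thesis by (simp add: h_def)
    qed
    have "f_op ?C i (h T) = map_option (Pair S) (f_op (ribbon_crystal (descent_composition lam S)) i Q)"
      by (simp add: h crystal_sum_def)
    also have "\<dots> = map_option (\<lambda>(k, b). (S, Q(ribbon_nodes lam S ! k := b))) ?act"
      unfolding ribbon_crystal_def f_op_chart[OF cQ] map_Q by (cases ?act) auto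
    also have "\<dots> = map_option (\<lambda>(k, b). h (T(standard_nodes lam S ! k := b))) ?act"
      using upd by (cases ?act) auto
    also have "\<dots> = map_option h (f_op (young_crystal lam reading) i T)"
      unfolding young f_op_chart[OF cT] by (cases ?act) auto
    finally show "f_op ?C i (h T) = map_option h (f_op (young_crystal lam reading) i T)" .
  qed
  then show ?thesis unfolding crystal_isomorphic_def by blast
qed

end
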